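(* Let $a>0$, $b>0$, $0<c<1$ with $ac\le 1$ and $b(1-c)\le 1$, and let $f_{a,b,c}$ be the piecewise linear Lorenz map on $[0,1]$ given by $f_{a,b,c}(x)=ax+1-ac$ for $x\in[0,c)$ and $f_{a,b,c}(x)=b(x-c)$ for $x\in(c,1]$. Then $f_{a,b,c}$ admits an invariant probability measure that is absolutely continuous with respect to the Lebesgue measure (an acim) if and only if $f_{a,b,c}(0)\le f_{a,b,c}(1)$, i.e. $ac+b(1-c)\ge 1$. More precisely: (1) If $ac+b(1-c)=1$, $(a,b)\ne(1,1)$ and $\log a/\log b$ is rational, then there exists a positive integer $n$ such that $f_{a,b,c}^n(x)=x$ for all $x\in[0,1]$ (as a map of the circle). Consequently, for each probability density $g$ on $[0,1]$, $A_n(g)=\frac1n\sum_{i=0}^{n-1}P_{a,b,c}^i g$ is the density of an invariant measure of $f_{a,b,c}$. (2) If $ac+b(1-c)=1$, $(a,b)\ne(1,1)$ and $\log a/\log b$ is irrational, then the acim is unique and its density $h$ satisfies $r\le h\le 1/r$ Lebesgue-a.e., where $r=\min\{(a/b)^4,(a/b)^{-4}\}$. (3) If $ac+b(1-c)>1$, then the acim is unique and its density is of bounded variation. (4) If $ac+b(1-c)<1$, then $f_{a,b,c}$ admits no acim.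
   Context: The map $f_{a,b,c}$ is not defined at $c$ (its one-sided limits there are $f(c-)=1$ and $f(c+)=0$); this is irrelevant for measure-theoretic statements. When $ac+b(1-c)=1$ one has $f_{a,b,c}(0)=f_{a,b,c}(1)$, and $f_{a,b,c}$ is regarded as a homeomorphism of the circle obtained from $[0,1]$ by identifying $0$ and $1$, sending $c$ to the point $0\sim1$; the identity $f^n_{a,b,c}(x)=x$ is understood in this sense. $P_{a,b,c}$ denotes the Frobenius-Perron operator of $f_{a,b,c}$ on $L^1([0,1])$: $$P_{a,b,c}h(x)=\frac{\mathbf 1_{[1-ac,1]}(x)}{a}\,h\!\left(\frac{x-(1-ac)}{a}\right)+\frac{\mathbf 1_{[0,b(1-c)]}(x)}{b}\,h\!\left(\frac{x+bc}{b}\right).$$ An acim of $f_{a,b,c}$ is an $f_{a,b,c}$-invariant Borel probability measure absolutely continuous with respect to Lebesgue measure. *)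

theory Defs
  imports "HOL-Probability.Probability"
begin

text \<open>The map is undefined at \<open>c\<close>; we assign the right limit \<open>0\<close> there. This affects no
  absolutely continuous measure, and on the circle \<open>[0,1]/0\<sim>1\<close> it is the required value.\<close>

definition lorenz_map :: "real \<Rightarrow> real \<Rightarrow> real \<Rightarrow> real \<Rightarrow> real" where
  "lorenz_map a b c x = (if x < c then a * x + 1 - a * c else b * (x - c))"

definition unit_lborel :: "real measure" where
  "unit_lborel = restrict_space lborel {0..1}"

definition invariant_measure :: "('a \<Rightarrow> 'a) \<Rightarrow> 'a measure \<Rightarrow> bool" where
  "invariant_measure T \<mu> \<longleftrightarrow> T \<in> measurable \<mu> \<mu> \<and> distr \<mu> \<mu> T = \<mu>"

definition acim :: "(real \<Rightarrow> real) \<Rightarrow> real measure \<Rightarrow> bool" where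
  "acim T \<mu> \<longleftrightarrow> prob_space \<mu> \<and> sets \<mu> = sets (restrict_space borel {0..1}) \<and>
     invariant_measure T \<mu> \<and> absolutely_continuous unit_lborel \<mu>"

definition prob_density :: "(real \<Rightarrow> real) \<Rightarrow> bool" where
  "prob_density g \<longleftrightarrow> integrable unit_lborel g \<and> (AE x in unit_lborel. 0 \<le> g x) \<and>
     integral\<^sup>L unit_lborel g = 1"

definition has_density :: "real measure \<Rightarrow> (real \<Rightarrow> real) \<Rightarrow> bool" where
  "has_density \<mu> h \<longleftrightarrow> h \<in> borel_measurable unit_lborel \<and> (AE x in unit_lborel. 0 \<le> h x) \<and>
     \<mu> = density unit_lborel (\<lambda>x. ennreal (h x))"

definition frobenius_perron ::
    "real \<Rightarrow> real \<Rightarrow> real \<Rightarrow> (real \<Rightarrow> real) \<Rightarrow> (real \<Rightarrow> real)" where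
  "frobenius_perron a b c h x =
     indicator {1 - a * c..1} x / a * h ((x - (1 - a * c)) / a) +
     indicator {0..b * (1 - c)} x / b * h ((x + b * c) / b)"

definition cesaro_mean ::
    "real \<Rightarrow> real \<Rightarrow> real \<Rightarrow> nat \<Rightarrow> (real \<Rightarrow> real) \<Rightarrow> (real \<Rightarrow> real)" where
  "cesaro_mean a b c n g x = (1 / real n) * (\<Sum>i<n. (frobenius_perron a b c ^^ i) g x)"

definition bounded_variation_on :: "real \<Rightarrow> real \<Rightarrow> (real \<Rightarrow> real) \<Rightarrow> bool" where
  "bounded_variation_on u v h \<longleftrightarrow>
     (\<exists>M. \<forall>n (x :: nat \<Rightarrow> real).
        (\<forall>i\<le>n. x i \<in> {u..v}) \<and> (\<forall>i<n. x i \<le> x (Suc i)) \<longrightarrow>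
        (\<Sum>i<n. \<bar>h (x (Suc i)) - h (x i)\<bar>) \<le> M)"

text \<open>Points of the circle are the classes of \<open>circle_rel\<close>. The induced map below is
  well defined on them exactly when \<open>0\<close> and \<open>1\<close> have equivalent images.\<close>

definition circle_rel :: "real rel" where
  "circle_rel = {(x, y). x \<in> {0..1} \<and> y \<in> {0..1} \<and> (x = y \<or> {x, y} = {0, 1})}"

definition circle_map :: "(real \<Rightarrow> real) \<Rightarrow> real set \<Rightarrow> real set" where
  "circle_map T X = circle_rel `` (T ` X)"

lemma equiv_circle_rel: "equiv {0..1} circle_rel"
proof (rule equivI)
  show "circle_rel \<subseteq> {0..1} \<times> {0..1}" "refl_on {0..1} circle_rel" "sym circle_rel"
    by (auto simp: circle_rel_def refl_on_def sym_def)
  show "trans circle_rel"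
    by (auto simp: circle_rel_def trans_def doubleton_eq_iff)
qed

lemma circle_map_class:
  assumes "0 < c" "c < 1" "a * c + b * (1 - c) = 1" "x \<in> {0..1}"
  shows "circle_map (lorenz_map a b c) (circle_rel `` {x}) = circle_rel `` {lorenz_map a b c x}"
proof -
  have "lorenz_map a b c 0 = lorenz_map a b c 1"
    using assms(1-3) by (simp add: lorenz_map_def algebra_simps)
  then have "lorenz_map a b c ` (circle_rel `` {x}) = {lorenz_map a b c x}"
    using assms(4) by (auto simp: circle_rel_def doubleton_eq_iff image_iff)
  then show ?thesis
    by (simp add: circle_map_def)
qed

end

theory Submission
  imports Defs "HOL-Analysis.Kronecker_Approximation_Theorem"
begin

text \<open>Measure lengths in \<open>[0,1]\<close> by \<open>dx / (1 + s x)\<close>. For a suitable \<open>s > -1\<close> both branches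
  of the map become contracting if \<open>a c + b (1 - c) < 1\<close>, isometric if it equals \<open>1\<close>, and
  expanding if it exceeds \<open>1\<close>.

  In the contracting case the map is injective, so the iterated images of \<open>[0,1]\<close>, which
  carry the full mass of any invariant measure, shrink to a null set.

  In the isometric case \<open>1 / (1 + s x)\<close> is an invariant density, \<open>1 + s = a / b\<close>, and
  \<open>ln (1 + s x) / ln (a / b)\<close> conjugates the map to the rotation by \<open>ln a / ln (a / b)\<close>.
  For irrational angle, the distribution function of an acim in this coordinate, minus the
  identity, is invariant under the rotation, hence constant.

  In the expanding case, let \<open>t_n\<close> be the orbit of \<open>t\<close> and \<open>D_n\<close> the product of the slopes
  along it. The series \<open>S_t = \<Sum>n. 1_[0,t_n] / D_n\<close> converges, and \<open>S_t - P S_t\<close> is \<open>1_[0,t]\<close> plus a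
  combination of \<open>1_[0,f(0)]\<close> and \<open>1\<close>, in which \<open>S_0\<close> eliminates \<open>1_[0,f(0)]\<close>. So \<open>1_[0,t] - t\<close> is a
  coboundary \<open>G_t - P G_t\<close> for every \<open>t\<close>. Then \<open>G_1\<close> is an invariant function, a difference of
  monotone functions, and the Cesaro means of Lebesgue measure converge to every acim,
  which gives uniqueness and the sign of \<open>G_1\<close>.\<close>

section \<open>Lebesgue measure on the unit interval\<close>

text \<open>One slope may lie on the wrong side of 1, so Lebesgue length itself need not be
  contracted or expanded. The sign of m (1 + s x) - (1 + s f(x)) is a linear condition on s, with
  threshold (a - 1) / (1 - a c) on the left branch (infinite if a c = 1) and (1 - b) / (b c) on the
  right one. After cross-multiplying, the order of the thresholds is the sign of a c + b (1 - c) -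
  1. Any s strictly between them serves both branches; at equality they coincide in a / b - 1.

  In the expanding case the weight only yields summability. The series works because P 1_[0,t] is
  1_[0,f(t)] / slope plus terms whose shape does not depend on t: a full left branch always covers
  [f(0),1]. So S_t misses a solution of S - P S = 1_[0,t] by two fixed functions only.

  The formula for G_1 does not reveal its sign. Invariance is therefore formulated for densities of
  any sign, by duality with bounded test functions, which also avoids transporting null sets through
  P.\<close>

lemma space_unit_lborel [simp]: "space unit_lborel = {0..1}"
  by (simp add: unit_lborel_def space_restrict_space)

lemma sets_unit_lborel [measurable_cong]: "sets unit_lborel = sets (restrict_space borel {0..1})"
  unfolding unit_lborel_def by (intro sets_restrict_space_cong) simp

lemma unit_interval_in_sets [simp]: "{0..1} \<in> sets unit_lborel"
  by (metis sets.top space_unit_lborel)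

interpretation unit_lborel: prob_space unit_lborel
  by (rule prob_spaceI) (simp add: unit_lborel_def emeasure_restrict_space space_restrict_space)

lemma integrable_unit_lborel_iff:
  "integrable unit_lborel g \<longleftrightarrow> integrable lborel (\<lambda>x. indicator {0..1} x * (g x :: real))"
  unfolding unit_lborel_def by (subst integrable_restrict_space) auto

lemma integral_unit_lborel:
  "integral\<^sup>L unit_lborel g = (\<integral>x. indicator {0..1} x * (g x :: real) \<partial>lborel)"
  unfolding unit_lborel_def by (subst integral_restrict_space) auto

lemma borel_measurable_unit_lborel_iff:
  "g \<in> borel_measurable unit_lborel \<longleftrightarrow>
    (\<lambda>x. indicator {0..1} x * (g x :: real)) \<in> borel_measurable borel"
  unfolding unit_lborel_def by (subst borel_measurable_restrict_space_iff) auto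

lemma borel_measurable_unit_lborelI: 
  "(g :: real \<Rightarrow> real) \<in> borel_measurable borel \<Longrightarrow> g \<in> borel_measurable unit_lborel"
  using borel_measurable_unit_lborel_iff[of g] by auto

lemma AE_unit_lborel_neq: "AE x in unit_lborel. x \<noteq> k"
  using AE_lborel_singleton[of k] unfolding unit_lborel_def
  by (subst AE_restrict_space_iff) auto

lemma integrable_mult_bounded:
  fixes g \<psi> :: "real \<Rightarrow> real"
  assumes "integrable unit_lborel g" "\<psi> \<in> borel_measurable unit_lborel"
    and "\<And>x. x \<in> {0..1} \<Longrightarrow> \<bar>\<psi> x\<bar> \<le> 1"
  shows "integrable unit_lborel (\<lambda>x. g x * \<psi> x)"
proof (rule Bochner_Integration.integrable_bound[OF assms(1)])
  show "(\<lambda>x. g x * \<psi> x) \<in> borel_measurable unit_lborel"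
    using assms by measurable
  show "AE x in unit_lborel. norm (g x * \<psi> x) \<le> norm (g x)"
    using assms(3) by (intro AE_I2) (auto simp: abs_mult mult_left_le)
qed

lemma integrable_bounded:
  fixes \<psi> :: "real \<Rightarrow> real"
  assumes "\<psi> \<in> borel_measurable unit_lborel"
    and "\<And>x. x \<in> {0..1} \<Longrightarrow> \<bar>\<psi> x\<bar> \<le> 1"
  shows "integrable unit_lborel \<psi>"
  using integrable_mult_bounded[of "\<lambda>_. 1", OF _ assms] by simp

lemma integral_atMost:
  assumes "t \<in> {0..1}"
  shows "(\<integral>x. of_bool (x \<le> t) \<partial>unit_lborel) = t"
proof -
  have "(\<integral>x. of_bool (x \<le> t) \<partial>unit_lborel) = ((\<integral>x. indicator {0..t} x \<partial>lborel) :: real)"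
    using assms unfolding integral_unit_lborel
    by (intro Bochner_Integration.integral_cong) (auto simp: indicator_def)
  also have "\<dots> = t" using assms by simp
  finally show ?thesis .
qed

lemma integrable_of_bool_atMost: "integrable unit_lborel (\<lambda>x::real. of_bool (x \<le> t) :: real)"
proof -
  have "(\<lambda>x::real. of_bool (x \<le> t) :: real) \<in> borel_measurable borel" by measurable
  then show ?thesis by (intro integrable_bounded borel_measurable_unit_lborelI) auto
qed

lemma abs_integral_mult_bounded:
  fixes g \<psi> :: "real \<Rightarrow> real"
  assumes "integrable unit_lborel g" "\<psi> \<in> borel_measurable unit_lborel"
    and "\<And>x. x \<in> {0..1} \<Longrightarrow> \<bar>\<psi> x\<bar> \<le> 1"
  shows "\<bar>\<integral>x. g x * \<psi> x \<partial>unit_lborel\<bar> \<le> (\<integral>x. \<bar>g x\<bar> \<partial>unit_lborel)"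
proof -
  have "\<bar>\<integral>x. g x * \<psi> x \<partial>unit_lborel\<bar> \<le> (\<integral>x. \<bar>g x * \<psi> x\<bar> \<partial>unit_lborel)"
    by (rule integral_abs_bound)
  also have "\<dots> \<le> (\<integral>x. \<bar>g x\<bar> \<partial>unit_lborel)"
    using assms(3)
    by (intro integral_mono integrable_abs integrable_mult_bounded[OF assms] assms(1))
       (auto simp: abs_mult mult_left_le)
  finally show ?thesis .
qed

section \<open>The transfer operator and invariant densities\<close>

locale lorenz =
  fixes a b c :: real
  assumes a_pos: "0 < a" and b_pos: "0 < b" and c_pos: "0 < c" and c_less_1: "c < 1"
    and ac_le_1: "a * c \<le> 1" and bc_le_1: "b * (1 - c) \<le> 1"
begin

abbreviation f :: "real \<Rightarrow> real" where "f \<equiv> lorenz_map a b c"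
abbreviation P :: "(real \<Rightarrow> real) \<Rightarrow> (real \<Rightarrow> real)" where "P \<equiv> frobenius_perron a b c"

lemma f_left: "x < c \<Longrightarrow> f x = a * x + 1 - a * c"
  and f_right: "c \<le> x \<Longrightarrow> f x = b * (x - c)"
  by (auto simp: lorenz_map_def)

lemma f_in_unit:
  assumes "x \<in> {0..1}"
  shows "f x \<in> {0..1}"
proof (cases "x < c")
  case True
  then have "a * x \<le> a * c" "0 \<le> a * x"
    using a_pos assms by auto
  then show ?thesis using True ac_le_1 by (auto simp: f_left)
next
  case False
  then have "b * (x - c) \<le> b * (1 - c)" "0 \<le> b * (x - c)"
    using b_pos assms by auto
  then show ?thesis using False bc_le_1 by (auto simp: f_right)
qed

lemma funpow_f_in_unit: "x \<in> {0..1} \<Longrightarrow> (f ^^ n) x \<in> {0..1}"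
  by (induction n) (use f_in_unit in auto)

lemma borel_measurable_f [measurable]: "f \<in> borel_measurable borel"
  unfolding lorenz_map_def by measurable

lemma measurable_f_restrict:
  "f \<in> measurable (restrict_space borel {0..1}) (restrict_space borel {0..1})"
  using f_in_unit by (intro measurable_restrict_space3) auto

lemma measurable_f [measurable]: "f \<in> measurable unit_lborel unit_lborel"
  using measurable_f_restrict measurable_cong_sets[OF sets_unit_lborel sets_unit_lborel] by blast

lemma measurable_funpow_f [measurable]: "f ^^ n \<in> measurable unit_lborel unit_lborel"
  by (induction n) (auto simp: id_def intro: measurable_compose[OF _ measurable_f])

lemma frobenius_perron_support: "y \<notin> {0..1} \<Longrightarrow> P g y = 0"
  using ac_le_1 bc_le_1 by (auto simp: frobenius_perron_def indicator_def)

text \<open>Substitution y = a x + 1 - a c. The closed branch [0,c] is taken because its image is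
  exactly the interval [1 - a c, 1] in the definition of \<open>P\<close>.\<close>

lemma integral_left_branch:
  fixes g \<psi> :: "real \<Rightarrow> real"
  assumes "integrable lborel (\<lambda>x. g x * indicator {0..c} x * \<psi> (a * x + 1 - a * c))"
  shows "integrable lborel (\<lambda>y. indicator {1 - a * c..1} y / a * g ((y - (1 - a * c)) / a) * \<psi> y)"
    and "(\<integral>y. indicator {1 - a * c..1} y / a * g ((y - (1 - a * c)) / a) * \<psi> y \<partial>lborel) =
      (\<integral>x. g x * indicator {0..c} x * \<psi> (a * x + 1 - a * c) \<partial>lborel)"
proof -
  let ?F = "\<lambda>x. g x * indicator {0..c} x * \<psi> (a * x + 1 - a * c)"
  have eq: "?F (-(1 - a * c) / a + (1 / a) * y) =
      a * (indicator {1 - a * c..1} y / a * g ((y - (1 - a * c)) / a) * \<psi> y)" for y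
  proof -
    have 1: "-(1 - a * c) / a + (1 / a) * y = (y - (1 - a * c)) / a"
      using a_pos by (simp add: field_simps)
    have 2: "a * ((y - (1 - a * c)) / a) + 1 - a * c = y"
      using a_pos by simp
    have 3: "indicator {0..c} ((y - (1 - a * c)) / a) = (indicator {1 - a * c..1} y :: real)"
      using a_pos by (auto simp: indicator_def field_simps)
    show ?thesis unfolding 1 2 3 using a_pos by simp
  qed
  have "integrable lborel (\<lambda>y. ?F (-(1 - a * c) / a + (1 / a) * y))"
    using a_pos by (intro lborel_integrable_real_affine[OF assms]) auto
  then show "integrable lborel (\<lambda>y. indicator {1 - a * c..1} y / a * g ((y - (1 - a * c)) / a) * \<psi> y)"
    unfolding eq using a_pos by (simp only: integrable_mult_left_iff) auto
  have "integral\<^sup>L lborel ?F = \<bar>1 / a\<bar> *\<^sub>R (\<integral>y. ?F (-(1 - a * c) / a + (1 / a) * y) \<partial>lborel)"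
    using a_pos by (intro lborel_integral_real_affine) auto
  then show "(\<integral>y. indicator {1 - a * c..1} y / a * g ((y - (1 - a * c)) / a) * \<psi> y \<partial>lborel) =
      (\<integral>x. g x * indicator {0..c} x * \<psi> (a * x + 1 - a * c) \<partial>lborel)"
    unfolding eq using a_pos by (simp only: integral_mult_right_zero) auto
qed

lemma integral_right_branch:
  fixes g \<psi> :: "real \<Rightarrow> real"
  assumes "integrable lborel (\<lambda>x. g x * indicator {c..1} x * \<psi> (b * (x - c)))"
  shows "integrable lborel (\<lambda>y. indicator {0..b * (1 - c)} y / b * g ((y + b * c) / b) * \<psi> y)"
    and "(\<integral>y. indicator {0..b * (1 - c)} y / b * g ((y + b * c) / b) * \<psi> y \<partial>lborel) =
      (\<integral>x. g x * indicator {c..1} x * \<psi> (b * (x - c)) \<partial>lborel)"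
proof -
  let ?F = "\<lambda>x. g x * indicator {c..1} x * \<psi> (b * (x - c))"
  have eq: "?F (c + (1 / b) * y) =
      b * (indicator {0..b * (1 - c)} y / b * g ((y + b * c) / b) * \<psi> y)" for y
  proof -
    have 1: "c + (1 / b) * y = (y + b * c) / b"
      using b_pos by (simp add: field_simps)
    have 2: "b * ((y + b * c) / b - c) = y"
      using b_pos by (simp add: field_simps)
    have 3: "indicator {c..1} ((y + b * c) / b) = (indicator {0..b * (1 - c)} y :: real)"
      using b_pos by (auto simp: indicator_def field_simps)
    show ?thesis unfolding 1 2 3 using b_pos by simp
  qed
  have "integrable lborel (\<lambda>y. ?F (c + (1 / b) * y))"
    using b_pos by (intro lborel_integrable_real_affine[OF assms]) auto
  then show "integrable lborel (\<lambda>y. indicator {0..b * (1 - c)} y / b * g ((y + b * c) / b) * \<psi> y)"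
    unfolding eq using b_pos by (simp only: integrable_mult_left_iff) auto
  have "integral\<^sup>L lborel ?F = \<bar>1 / b\<bar> *\<^sub>R (\<integral>y. ?F (c + (1 / b) * y) \<partial>lborel)"
    using b_pos by (intro lborel_integral_real_affine) auto
  then show "(\<integral>y. indicator {0..b * (1 - c)} y / b * g ((y + b * c) / b) * \<psi> y \<partial>lborel) =
      (\<integral>x. g x * indicator {c..1} x * \<psi> (b * (x - c)) \<partial>lborel)"
    unfolding eq using b_pos by (simp only: integral_mult_right_zero) auto
qed

text \<open>Each branch has its own substitution, and the two integrals recombine because [0,c] and
  [c,1] overlap in a single point. Test functions bounded by 1 keep every product with
  \<open>g\<close> integrable.\<close>

lemma frobenius_perron_dual:
  fixes g \<psi> :: "real \<Rightarrow> real"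
  assumes g: "integrable unit_lborel g" and \<psi>: "\<psi> \<in> borel_measurable unit_lborel"
    and \<psi>_le: "\<And>x. x \<in> {0..1} \<Longrightarrow> \<bar>\<psi> x\<bar> \<le> 1"
  shows "integrable unit_lborel (\<lambda>x. P g x * \<psi> x)"
    and "(\<integral>x. P g x * \<psi> x \<partial>unit_lborel) = (\<integral>x. g x * \<psi> (f x) \<partial>unit_lborel)"
proof -
  let ?L = "\<lambda>x. g x * indicator {0..c} x * \<psi> (a * x + 1 - a * c)"
  let ?R = "\<lambda>x. g x * indicator {c..1} x * \<psi> (b * (x - c))"
  let ?L' = "\<lambda>y. indicator {1 - a * c..1} y / a * g ((y - (1 - a * c)) / a) * \<psi> y"
  let ?R' = "\<lambda>y. indicator {0..b * (1 - c)} y / b * g ((y + b * c) / b) * \<psi> y"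
  have "integrable unit_lborel (\<lambda>x. g x * \<psi> (f x))"
    using f_in_unit \<psi>_le by (intro integrable_mult_bounded[OF g] measurable_compose[OF measurable_f \<psi>]) auto
  then have I: "integrable lborel (\<lambda>x. indicator {0..1} x * (g x * \<psi> (f x)))"
    by (simp add: integrable_unit_lborel_iff)
  have AE_ne: "AE x in lborel. x \<noteq> c"
    by (rule AE_lborel_singleton)
  \<comment> \<open>At \<open>c\<close> the function \<open>?L\<close> uses the left limit 1 of the
    map, whereas \<open>f c = 0\<close>. The value at \<open>c\<close> is first cut out and then
    added back to recover measurability.\<close>
  have L: "integrable lborel ?L"
  proof -
    have *: "integrable lborel (\<lambda>x. indicator {0..<c} x * (indicator {0..1} x * (g x * \<psi> (f x))))"
      using integrable_mult_indicator[OF _ I, of "{0..<c}"] by simp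
    have "integrable lborel (\<lambda>x. ?L x * indicator (- {c}) x)"
      by (rule Bochner_Integration.integrable_cong[THEN iffD1, OF refl _ *])
         (use c_less_1 in \<open>auto simp: indicator_def f_left\<close>)
    then show ?thesis
    proof -
      have "(\<lambda>x. indicator {c} x * ?L c) \<in> borel_measurable borel"
        by measurable
      moreover have "(\<lambda>x. ?L x) = (\<lambda>x. ?L x * indicator (- {c}) x + indicator {c} x * ?L c)"
        by (auto simp: indicator_def)
      ultimately have "?L \<in> borel_measurable lborel"
        using borel_measurable_add[OF borel_measurable_integrable[OF \<open>integrable lborel (\<lambda>x. ?L x * indicator (- {c}) x)\<close>],
            of "\<lambda>x. indicator {c} x * ?L c"] by simp
      then show ?thesis
        using \<open>integrable lborel (\<lambda>x. ?L x * indicator (- {c}) x)\<close> AE_ne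
        by (subst integrable_cong_AE[where g="\<lambda>x. ?L x * indicator (- {c}) x"])
           (auto elim!: AE_mp simp: indicator_def)
    qed
  qed
  have R: "integrable lborel ?R"
  proof -
    have *: "integrable lborel (\<lambda>x. indicator {c..1} x * (indicator {0..1} x * (g x * \<psi> (f x))))"
      using integrable_mult_indicator[OF _ I, of "{c..1}"] by simp
    show ?thesis
      by (rule Bochner_Integration.integrable_cong[THEN iffD1, OF refl _ *])
         (use c_pos in \<open>auto simp: indicator_def f_right\<close>)
  qed
  note L' = integral_left_branch[OF L] and R' = integral_right_branch[OF R]
  have P_eq: "indicator {0..1} x * (P g x * \<psi> x) = ?L' x + ?R' x" for x
    using frobenius_perron_support[of x g] ac_le_1 bc_le_1
    by (auto simp: indicator_def frobenius_perron_def algebra_simps)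
  show "integrable unit_lborel (\<lambda>x. P g x * \<psi> x)"
    unfolding integrable_unit_lborel_iff P_eq using L' R' by (intro Bochner_Integration.integrable_add)
  have "(\<integral>x. P g x * \<psi> x \<partial>unit_lborel) = integral\<^sup>L lborel ?L' + integral\<^sup>L lborel ?R'"
    unfolding integral_unit_lborel P_eq using L' R' by (intro Bochner_Integration.integral_add)
  also have "\<dots> = (\<integral>x. ?L x + ?R x \<partial>lborel)"
    unfolding L'(2) R'(2) using L R by (intro Bochner_Integration.integral_add[symmetric])
  also have "\<dots> = (\<integral>x. indicator {0..1} x * (g x * \<psi> (f x)) \<partial>lborel)"
  proof (rule integral_cong_AE)
    show "AE x in lborel. ?L x + ?R x = indicator {0..1} x * (g x * \<psi> (f x))"
      using AE_ne by eventually_elim (use c_pos c_less_1 in \<open>auto simp: indicator_def f_left f_right\<close>)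
  qed (use L R I in auto)
  also have "\<dots> = (\<integral>x. g x * \<psi> (f x) \<partial>unit_lborel)"
    by (simp add: integral_unit_lborel)
  finally show "(\<integral>x. P g x * \<psi> x \<partial>unit_lborel) = (\<integral>x. g x * \<psi> (f x) \<partial>unit_lborel)" .
qed

lemma integrable_frobenius_perron:
  "integrable unit_lborel g \<Longrightarrow> integrable unit_lborel (P g)"
  using frobenius_perron_dual(1)[of g "\<lambda>_. 1"] by simp

end

section \<open>Invariant densities versus invariant measures\<close>

lemma indicator_test_function:
  assumes "B \<in> sets unit_lborel"
  shows "(indicator B :: real \<Rightarrow> real) \<in> borel_measurable unit_lborel"
    and "\<bar>indicator B x :: real\<bar> \<le> 1"
  using assms by (auto simp: indicator_def)

lemma emeasure_density_real:
  assumes "integrable M h" "AE x in M. 0 \<le> (h x :: real)" "B \<in> sets M"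
  shows "emeasure (density M (\<lambda>x. ennreal (h x))) B = ennreal (\<integral>x. h x * indicator B x \<partial>M)"
proof -
  have "emeasure (density M (\<lambda>x. ennreal (h x))) B = (\<integral>\<^sup>+x. ennreal (h x) * indicator B x \<partial>M)"
    using assms by (intro emeasure_density) auto
  also have "\<dots> = (\<integral>\<^sup>+x. ennreal (h x * indicator B x) \<partial>M)"
    by (intro nn_integral_cong) (auto simp: indicator_def)
  also have "\<dots> = ennreal (\<integral>x. h x * indicator B x \<partial>M)"
    using assms integrable_real_mult_indicator[of B M h]
    by (intro nn_integral_eq_integral) (auto elim!: AE_mp simp: mult.commute)
  finally show ?thesis .
qed

definition weakly_invariant :: "(real \<Rightarrow> real) \<Rightarrow> (real \<Rightarrow> real) \<Rightarrow> bool" where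
  "weakly_invariant T h \<longleftrightarrow> (\<forall>\<psi>. \<psi> \<in> borel_measurable unit_lborel \<and> (\<forall>x\<in>{0..1}. \<bar>\<psi> x\<bar> \<le> 1) \<longrightarrow>
    (\<integral>x. h x * \<psi> (T x) \<partial>unit_lborel) = (\<integral>x. h x * \<psi> x \<partial>unit_lborel))"

lemma weakly_invariantI:
  assumes "\<And>\<psi>. \<psi> \<in> borel_measurable unit_lborel \<Longrightarrow> (\<And>x. x \<in> {0..1} \<Longrightarrow> \<bar>\<psi> x\<bar> \<le> 1) \<Longrightarrow>
    (\<integral>x. h x * \<psi> (T x) \<partial>unit_lborel) = (\<integral>x. h x * \<psi> x \<partial>unit_lborel)"
  shows "weakly_invariant T h"
  using assms unfolding weakly_invariant_def by blast

lemma weakly_invariantD: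
  assumes "weakly_invariant T h" "\<psi> \<in> borel_measurable unit_lborel" "\<And>x. x \<in> {0..1} \<Longrightarrow> \<bar>\<psi> x\<bar> \<le> 1"
  shows "(\<integral>x. h x * \<psi> (T x) \<partial>unit_lborel) = (\<integral>x. h x * \<psi> x \<partial>unit_lborel)"
  using assms unfolding weakly_invariant_def by blast

lemma weakly_invariant_divide:
  "weakly_invariant T h \<Longrightarrow> weakly_invariant T (\<lambda>x. h x / k)"
  by (simp add: weakly_invariant_def)

lemma acimI:
  fixes h :: "real \<Rightarrow> real"
  assumes T: "T \<in> measurable unit_lborel unit_lborel"
    and h: "integrable unit_lborel h" "AE x in unit_lborel. 0 \<le> h x" "(\<integral>x. h x \<partial>unit_lborel) = 1"
    and inv: "weakly_invariant T h"
  shows "acim T (density unit_lborel (\<lambda>x. ennreal (h x)))"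
proof -
  let ?\<mu> = "density unit_lborel (\<lambda>x. ennreal (h x))"
  have meas: "T \<in> measurable ?\<mu> ?\<mu>" using T by simp
  have "prob_space ?\<mu>"
  proof (rule prob_spaceI)
    have "emeasure ?\<mu> (space ?\<mu>) = ennreal (\<integral>x. h x * indicator (space unit_lborel) x \<partial>unit_lborel)"
      using h by (subst emeasure_density_real) auto
    also have "(\<integral>x. h x * indicator (space unit_lborel) x \<partial>unit_lborel) = (\<integral>x. h x \<partial>unit_lborel)"
      by (intro Bochner_Integration.integral_cong) auto
    finally show "emeasure ?\<mu> (space ?\<mu>) = 1" using h by simp
  qed
  moreover have "distr ?\<mu> ?\<mu> T = ?\<mu>"
  proof (rule measure_eqI)
    fix B assume "B \<in> sets (distr ?\<mu> ?\<mu> T)"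
    then have B: "B \<in> sets unit_lborel" by simp
    have TB: "T -` B \<inter> space unit_lborel \<in> sets unit_lborel"
      using T B by (rule measurable_sets)
    have "emeasure (distr ?\<mu> ?\<mu> T) B = emeasure ?\<mu> (T -` B \<inter> space unit_lborel)"
      using meas B by (subst emeasure_distr) auto
    also have "\<dots> = ennreal (\<integral>x. h x * indicator (T -` B \<inter> space unit_lborel) x \<partial>unit_lborel)"
      using h TB by (subst emeasure_density_real) auto
    also have "(\<integral>x. h x * indicator (T -` B \<inter> space unit_lborel) x \<partial>unit_lborel) =
        (\<integral>x. h x * indicator B (T x) \<partial>unit_lborel)"
      by (intro Bochner_Integration.integral_cong) (auto simp: indicator_def)
    also have "\<dots> = (\<integral>x. h x * indicator B x \<partial>unit_lborel)"
      by (rule weakly_invariantD[OF inv]) (use indicator_test_function[OF B] in auto)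
    also have "ennreal \<dots> = emeasure ?\<mu> B"
      using h B by (subst emeasure_density_real) auto
    finally show "emeasure (distr ?\<mu> ?\<mu> T) B = emeasure ?\<mu> B" .
  qed simp
  moreover have "absolutely_continuous unit_lborel ?\<mu>"
    using h by (intro absolutely_continuousI_density) auto
  ultimately show ?thesis
    using meas by (simp add: acim_def invariant_measure_def sets_unit_lborel)
qed

text \<open>Radon-Nikodym, with a version that is real and nonnegative everywhere, so that later
  comparisons hold pointwise.\<close>

lemma acim_density:
  assumes T: "T \<in> measurable unit_lborel unit_lborel" and \<mu>: "acim T \<mu>"
  obtains h :: "real \<Rightarrow> real" where "integrable unit_lborel h" "\<forall>x. 0 \<le> h x"
    "(\<integral>x. h x \<partial>unit_lborel) = 1" "\<mu> = density unit_lborel (\<lambda>x. ennreal (h x))" "weakly_invariant T h"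
proof -
  interpret \<mu>: prob_space \<mu> using \<mu> by (simp add: acim_def)
  have sets: "sets \<mu> = sets unit_lborel"
    using \<mu> by (simp add: acim_def sets_unit_lborel)
  have ac: "absolutely_continuous unit_lborel \<mu>" using \<mu> by (simp add: acim_def)
  obtain h where h: "h \<in> borel_measurable unit_lborel"
      "AE x in unit_lborel. RN_deriv unit_lborel \<mu> x = ennreal (h x)" "\<And>x. 0 \<le> h x"
    using unit_lborel.real_RN_deriv[OF \<mu>.finite_measure_axioms ac sets] by metis
  have dens: "\<mu> = density unit_lborel (\<lambda>x. ennreal (h x))"
  proof -
    have "\<mu> = density unit_lborel (RN_deriv unit_lborel \<mu>)"
      using unit_lborel.density_RN_deriv[OF ac sets] by simp
    also have "\<dots> = density unit_lborel (\<lambda>x. ennreal (h x))"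
      using h by (intro density_cong) auto
    finally show ?thesis .
  qed
  have one: "(\<integral>\<^sup>+x. ennreal (h x) \<partial>unit_lborel) = 1"
  proof -
    have "1 = emeasure \<mu> (space \<mu>)" by (simp add: \<mu>.emeasure_space_1)
    also have "\<dots> = (\<integral>\<^sup>+x. ennreal (h x) * indicator (space unit_lborel) x \<partial>unit_lborel)"
      unfolding dens using h by (subst emeasure_density) auto
    also have "\<dots> = (\<integral>\<^sup>+x. ennreal (h x) \<partial>unit_lborel)"
      by (intro nn_integral_cong) auto
    finally show ?thesis by simp
  qed
  have int: "integrable unit_lborel h"
    using h one by (intro integrableI_nonneg) auto
  have "ennreal (\<integral>x. h x \<partial>unit_lborel) = 1"
    using nn_integral_eq_integral[OF int] h one by simp
  then have one': "(\<integral>x. h x \<partial>unit_lborel) = 1" by simp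
  have inv: "(\<integral>x. h x * \<psi> (T x) \<partial>unit_lborel) = (\<integral>x. h x * \<psi> x \<partial>unit_lborel)"
    if \<psi>: "\<psi> \<in> borel_measurable unit_lborel" for \<psi> :: "real \<Rightarrow> real"
  proof -
    have T': "T \<in> measurable \<mu> \<mu>" and dT: "distr \<mu> \<mu> T = \<mu>"
      using \<mu> by (auto simp: acim_def invariant_measure_def)
    have \<psi>': "\<psi> \<in> borel_measurable \<mu>"
      using \<psi> measurable_cong_sets[OF sets refl] by blast
    have "(\<integral>x. h x * \<psi> (T x) \<partial>unit_lborel) = (\<integral>x. \<psi> (T x) \<partial>\<mu>)"
      unfolding dens using h \<psi> T by (subst integral_real_density) auto
    also have "\<dots> = (\<integral>x. \<psi> x \<partial>distr \<mu> \<mu> T)"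
      using T' \<psi>' by (subst integral_distr) auto
    also have "\<dots> = (\<integral>x. h x * \<psi> x \<partial>unit_lborel)"
      unfolding dT unfolding dens using h \<psi> by (subst integral_real_density) auto
    finally show ?thesis .
  qed
  show ?thesis
    by (rule that[OF int allI[OF h(3)] one' dens weakly_invariantI[OF inv]])
qed

context lorenz
begin

lemma P_eq_imp_invariant:
  assumes g: "integrable unit_lborel g" and P: "AE x in unit_lborel. P g x = g x"
  shows "weakly_invariant f g"
proof (rule weakly_invariantI)
  fix \<psi> :: "real \<Rightarrow> real"
  assume \<psi>: "\<psi> \<in> borel_measurable unit_lborel" "\<And>x. x \<in> {0..1} \<Longrightarrow> \<bar>\<psi> x\<bar> \<le> 1"
  have "(\<integral>x. g x * \<psi> (f x) \<partial>unit_lborel) = (\<integral>x. P g x * \<psi> x \<partial>unit_lborel)"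
    using frobenius_perron_dual(2)[OF g \<psi>] by simp
  also have "\<dots> = (\<integral>x. g x * \<psi> x \<partial>unit_lborel)"
    using P integrable_frobenius_perron[OF g] g \<psi>(1)
    by (intro integral_cong_AE) (auto elim!: AE_mp)
  finally show "(\<integral>x. g x * \<psi> (f x) \<partial>unit_lborel) = (\<integral>x. g x * \<psi> x \<partial>unit_lborel)" .
qed

section \<open>Weights adapted to both branches\<close>

text \<open>Relative to the weight \<open>1 / (1 + s x)\<close>, a branch of slope \<open>m\<close> has derivative
  \<open>m (1 + s x) / (1 + s f(x))\<close>. Numerator minus denominator is constant on each branch.\<close>

lemma weight_left: "x < c \<Longrightarrow> a * (1 + s * x) - (1 + s * f x) = a - 1 - s * (1 - a * c)"
  by (simp add: f_left algebra_simps)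

lemma weight_right: "c \<le> x \<Longrightarrow> b * (1 + s * x) - (1 + s * f x) = b - 1 + s * b * c"
  by (simp add: f_right algebra_simps)

lemma weight_pos:
  assumes "-1 < s" "x \<in> {0..1}"
  shows "0 < 1 + s * (x::real)" "min 1 (1 + s) \<le> 1 + s * x" "1 + s * x \<le> max 1 (1 + s)"
proof -
  show 1: "min 1 (1 + s) \<le> 1 + s * x"
  proof (cases "0 \<le> s")
    case False
    then have "s * 1 \<le> s * x" using assms by (intro mult_left_mono_neg) auto
    then show ?thesis by simp
  qed (use assms in auto)
  then show "0 < 1 + s * x" using assms by auto
  show "1 + s * x \<le> max 1 (1 + s)"
  proof (cases "0 \<le> s")
    case True
    then have "s * x \<le> s * 1" using assms by (intro mult_left_mono) auto
    then show ?thesis by simp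
  next
    case False
    then show ?thesis using assms by (auto simp: mult_nonpos_nonneg le_max_iff_disj)
  qed
qed

text \<open>The conditions amount to (1 - b) / (b c) < s < (a - 1) / (1 - a c), and the hypothesis
  is exactly that this interval is nonempty. Its lower end is at least -1 because
  \<open>b * (1 - c) \<le> 1\<close>.\<close>

lemma overlap_pos_weight:
  assumes "a * c + b * (1 - c) > 1"
  obtains s where "-1 < s" "0 < a - 1 - s * (1 - a * c)" "0 < b - 1 + s * b * c"
proof -
  have bc: "0 < b * c" using b_pos c_pos by simp
  have lo: "-1 \<le> (1 - b) / (b * c)" using bc bc_le_1 by (simp add: field_simps)
  show ?thesis
  proof (cases "a * c = 1")
    \<comment> \<open>The left condition is now \<open>1 < a\<close>, whatever \<open>s\<close> is,
      so it suffices to exceed the right threshold, here by 1.\<close>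
    case True
    then have "1 < a" using a_pos c_less_1 by (metis mult.right_neutral mult_less_cancel_left_pos)
    have "(1 - b) < ((1 - b) / (b * c) + 1) * (b * c)"
      using bc b_pos c_pos by (simp only: distrib_right) simp
    then show ?thesis
      using True \<open>1 < a\<close> lo by (intro that[of "(1 - b) / (b * c) + 1"]) (auto simp: mult.assoc)
  next
    case False
    then have ac: "0 < 1 - a * c" using ac_le_1 by simp
    have "(1 - b) * (1 - a * c) < (a - 1) * (b * c)"
      using assms by (simp add: algebra_simps)
    then have "(1 - b) / (b * c) < (a - 1) / (1 - a * c)"
      by (simp only: pos_divide_less_eq[OF bc] times_divide_eq_left pos_less_divide_eq[OF ac])
    then obtain s where "(1 - b) / (b * c) < s" "s < (a - 1) / (1 - a * c)"
      using dense by blast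
    moreover from this have "-1 < s" using lo by linarith
    ultimately show ?thesis
      using bc ac by (intro that[of s]) (auto simp: divide_less_eq less_divide_eq mult.assoc)
  qed
qed

text \<open>The same two thresholds in the opposite order. Both are finite since the gap forces
  \<open>a * c < 1\<close>, and the lower one exceeds -1 because \<open>c < 1\<close>.\<close>

lemma gap_weight:
  assumes "a * c + b * (1 - c) < 1"
  obtains s where "-1 < s" "a - 1 - s * (1 - a * c) < 0" "b - 1 + s * b * c < 0"
proof -
  have bc: "0 < b * c" using b_pos c_pos by simp
  have "0 < b * (1 - c)" using b_pos c_less_1 by simp
  then have ac: "0 < 1 - a * c" using assms by simp
  have "a * c < a" using a_pos c_less_1 by simp
  then have lo: "-1 < (a - 1) / (1 - a * c)" using ac by (simp add: less_divide_eq)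
  have "(a - 1) * (b * c) < (1 - b) * (1 - a * c)"
    using assms by (simp add: algebra_simps)
  then have "(a - 1) / (1 - a * c) < (1 - b) / (b * c)"
    by (simp only: pos_divide_less_eq[OF ac] times_divide_eq_left pos_less_divide_eq[OF bc])
  then obtain s where "s < (1 - b) / (b * c)" "(a - 1) / (1 - a * c) < s"
    using dense by blast
  moreover from this have "-1 < s" using lo by linarith
  ultimately show ?thesis
    using bc ac by (intro that[of s]) (auto simp: divide_less_eq less_divide_eq mult.assoc)
qed

end

section \<open>The contracting case\<close>

context lorenz
begin

definition slope :: "real \<Rightarrow> real" where
  "slope x = (if x < c then a else b)"

lemma slope_pos: "0 < slope x"
  using a_pos b_pos by (simp add: slope_def)

lemma borel_measurable_slope [measurable]: "slope \<in> borel_measurable borel"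
  unfolding slope_def by measurable

text \<open>The image of \<open>A\<close> under \<open>f\<close>, up to the single point 1.
  Describing it through \<open>P\<close> gives measurability without any result on images of Borel
  sets.\<close>

definition transfer_support :: "real set \<Rightarrow> real set" where
  "transfer_support A = {y \<in> {0..1}. P (indicator A) y > 0}"

lemma transfer_support_measurable:
  assumes "A \<in> sets unit_lborel"
  shows "transfer_support A \<in> sets unit_lborel"
proof -
  have "integrable unit_lborel (indicator A :: real \<Rightarrow> real)"
    using indicator_test_function[OF assms] by (intro integrable_bounded) auto
  then have [measurable]: "P (indicator A) \<in> borel_measurable unit_lborel"
    using integrable_frobenius_perron by blast
  have "{y \<in> space unit_lborel. P (indicator A) y > 0} \<in> sets unit_lborel"
    by measurable
  then show ?thesis by (simp add: transfer_support_def)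
qed

lemma image_in_transfer_support:
  assumes "x \<in> A" "x \<in> {0..1}"
  shows "f x \<in> transfer_support A"
proof (cases "x < c")
  case True
  have eq: "(f x - (1 - a * c)) / a = x"
    using True a_pos by (simp add: f_left)
  have "f x \<in> {1 - a * c..1}"
    using True a_pos assms by (auto simp: f_left)
  then have "0 < indicator {1 - a * c..1} (f x) / a * indicator A ((f x - (1 - a * c)) / a)"
    using assms eq a_pos by simp
  moreover have "0 \<le> indicator {0..b * (1 - c)} (f x) / b * indicator A ((f x + b * c) / b)"
    using b_pos by simp
  ultimately show ?thesis
    using f_in_unit[OF assms(2)] unfolding transfer_support_def frobenius_perron_def
    by (auto intro: add_pos_nonneg)
next
  case False
  have eq: "(f x + b * c) / b = x"
    using False b_pos by (simp add: f_right field_simps)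
  have "f x \<in> {0..b * (1 - c)}"
    using False b_pos assms by (auto simp: f_right)
  then have "0 < indicator {0..b * (1 - c)} (f x) / b * indicator A ((f x + b * c) / b)"
    using assms eq b_pos by simp
  moreover have "0 \<le> indicator {1 - a * c..1} (f x) / a * indicator A ((f x - (1 - a * c)) / a)"
    using a_pos by simp
  ultimately show ?thesis
    using f_in_unit[OF assms(2)] unfolding transfer_support_def frobenius_perron_def
    by (auto intro: add_nonneg_pos)
qed

context
  fixes s :: real
  assumes s: "-1 < s"
begin

lemma integrable_inverse_weight: "integrable unit_lborel (\<lambda>x. 1 / (1 + s * x))"
proof (rule unit_lborel.integrable_const_bound)
  show "AE x in unit_lborel. norm (1 / (1 + s * x)) \<le> 1 / min 1 (1 + s)"
  proof (rule AE_I2)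
    fix x assume "x \<in> space unit_lborel"
    then show "norm (1 / (1 + s * x)) \<le> 1 / min 1 (1 + s)"
      using weight_pos[OF s, of x] s by (auto intro!: divide_left_mono)
  qed
  show "(\<lambda>x. 1 / (1 + s * x)) \<in> borel_measurable unit_lborel"
    by (intro borel_measurable_unit_lborelI) measurable
qed

lemma integrable_inverse_weight_indicator:
  assumes "A \<in> sets unit_lborel"
  shows "integrable unit_lborel (\<lambda>x. 1 / (1 + s * x) * indicator A x)"
  using integrable_inverse_weight indicator_test_function[OF assms]
  by (intro integrable_mult_bounded) auto

text \<open>The branch constants give slope (1 + s x) \<le> (1 + s f(x)) - d. Since 1 + s f(x) is at
  most \<open>max 1 (1 + s)\<close>, subtracting \<open>d\<close> gains a uniform factor.\<close>

lemma weight_ratio_le: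
  assumes "a - 1 - s * (1 - a * c) \<le> - d" "b - 1 + s * b * c \<le> - d" "0 \<le> d" "x \<in> {0..1}"
  shows "slope x / (1 + s * f x) \<le> (1 - d / max 1 (1 + s)) / (1 + s * x)"
proof -
  have fx: "f x \<in> {0..1}" using f_in_unit assms by blast
  have "slope x * (1 + s * x) - (1 + s * f x) \<le> - d"
    using weight_left[of x s] weight_right[of x s] assms(1,2) by (auto simp: slope_def)
  moreover have "d / max 1 (1 + s) * (1 + s * f x) \<le> d"
    using mult_left_mono[OF weight_pos(3)[OF s fx] \<open>0 \<le> d\<close>] by (simp add: divide_le_eq)
  ultimately have "slope x * (1 + s * x) \<le> (1 - d / max 1 (1 + s)) * (1 + s * f x)"
    by (simp add: algebra_simps)
  then show ?thesis
    by (simp only: pos_divide_le_eq[OF weight_pos(1)[OF s fx]] times_divide_eq_left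
      pos_le_divide_eq[OF weight_pos(1)[OF s assms(4)]])
qed

text \<open>With a gap the branch images are disjoint, so \<open>P\<close> has at most one term and
  the slope cancels its denominator. The point 1 is exceptional: its left preimage is
  \<open>c\<close>, where \<open>slope\<close> and \<open>f\<close> follow the right branch.\<close>

lemma transfer_weight:
  assumes gap: "a * c + b * (1 - c) < 1" and A: "A \<in> sets unit_lborel"
  shows "AE y in unit_lborel. P (\<lambda>x. slope x / (1 + s * f x) * indicator A x) y =
    1 / (1 + s * y) * indicator (transfer_support A) y"
proof -
  have ne: "AE y in unit_lborel. y \<noteq> 1"
    by (rule AE_unit_lborel_neq)
  let ?g = "\<lambda>x. slope x / (1 + s * f x) * indicator A x :: real"
  have *: "P ?g y = 1 / (1 + s * y) * indicator (transfer_support A) y"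
    if y: "y \<in> {0..1}" "y \<noteq> 1" for y
  proof -
    consider "y \<in> {1 - a * c..1}" "y \<notin> {0..b * (1 - c)}"
      | "y \<notin> {1 - a * c..1}" "y \<in> {0..b * (1 - c)}"
      | "y \<notin> {1 - a * c..1}" "y \<notin> {0..b * (1 - c)}"
      using gap by fastforce
    then show ?thesis
    proof cases
      case 1
      let ?x = "(y - (1 - a * c)) / a"
      have "?x < c" using y a_pos by (simp add: divide_less_eq mult.commute)
      then have "slope ?x = a" "f ?x = y" using a_pos by (simp_all add: slope_def f_left)
      moreover have "P h y = h ?x / a" for h
        using 1 by (simp add: frobenius_perron_def)
      ultimately show ?thesis
        using y a_pos by (auto simp: transfer_support_def indicator_def)
    next
      case 2
      let ?x = "(y + b * c) / b"
      have "c \<le> ?x" using 2 b_pos by (simp add: le_divide_eq mult.commute)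
      then have "slope ?x = b" "f ?x = y"
        using b_pos by (simp_all add: slope_def f_right right_diff_distrib)
      moreover have "P h y = h ?x / b" for h
        using 2 by (simp add: frobenius_perron_def)
      ultimately show ?thesis
        using y b_pos by (auto simp: transfer_support_def indicator_def)
    next
      case 3
      then have "P h y = 0" for h
        by (simp add: frobenius_perron_def)
      then show ?thesis by (simp add: transfer_support_def)
    qed
  qed
  show ?thesis
    using ne AE_space by eventually_elim (use * in auto)
qed

lemma integrable_slope_weight:
  assumes "A \<in> sets unit_lborel"
  shows "integrable unit_lborel (\<lambda>x. slope x / (1 + s * f x) * indicator A x)"
proof (rule unit_lborel.integrable_const_bound)
  show "AE x in unit_lborel. norm (slope x / (1 + s * f x) * indicator A x) \<le> max a b / min 1 (1 + s)"
  proof (rule AE_I2)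
    fix x assume "x \<in> space unit_lborel"
    then have "f x \<in> {0..1}" using f_in_unit by simp
    then have "slope x / (1 + s * f x) \<le> max a b / min 1 (1 + s)"
      using weight_pos[OF s, of "f x"] s a_pos by (intro frac_le) (auto simp: slope_def)
    moreover have "0 \<le> slope x / (1 + s * f x)"
      using weight_pos[OF s \<open>f x \<in> {0..1}\<close>] slope_pos[of x] by simp
    ultimately have "\<bar>slope x / (1 + s * f x)\<bar> \<le> max a b / min 1 (1 + s)" "0 \<le> max a b / min 1 (1 + s)"
      by linarith+
    then show "norm (slope x / (1 + s * f x) * indicator A x) \<le> max a b / min 1 (1 + s)"
      by (cases "x \<in> A") simp_all
  qed
  have "(\<lambda>x. slope x / (1 + s * f x)) \<in> borel_measurable unit_lborel"
    by (intro borel_measurable_unit_lborelI) measurable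
  then show "(\<lambda>x. slope x / (1 + s * f x) * indicator A x) \<in> borel_measurable unit_lborel"
    using assms by measurable
qed

text \<open>Duality with the test function 1 turns the weighted size of the image into an integral
  over \<open>A\<close> of the pulled back weight, where the pointwise ratio bound applies.\<close>

lemma transfer_support_contracts:
  assumes gap: "a * c + b * (1 - c) < 1" and A: "A \<in> sets unit_lborel"
    and d: "a - 1 - s * (1 - a * c) \<le> - d" "b - 1 + s * b * c \<le> - d" "0 \<le> d"
  shows "(\<integral>y. 1 / (1 + s * y) * indicator (transfer_support A) y \<partial>unit_lborel) \<le>
    (1 - d / max 1 (1 + s)) * (\<integral>x. 1 / (1 + s * x) * indicator A x \<partial>unit_lborel)"
proof -
  let ?g = "\<lambda>x. slope x / (1 + s * f x) * indicator A x :: real"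
  have "(\<integral>y. 1 / (1 + s * y) * indicator (transfer_support A) y \<partial>unit_lborel) = (\<integral>y. P ?g y \<partial>unit_lborel)"
    using transfer_weight[OF gap A] transfer_support_measurable[OF A]
      integrable_frobenius_perron[OF integrable_slope_weight[OF A]]
      integrable_inverse_weight_indicator
    by (intro integral_cong_AE) (auto elim!: AE_mp)
  also have "\<dots> = (\<integral>x. ?g x \<partial>unit_lborel)"
    using frobenius_perron_dual(2)[OF integrable_slope_weight[OF A], of "\<lambda>_. 1"] by simp
  also have "\<dots> \<le> (\<integral>x. (1 - d / max 1 (1 + s)) * (1 / (1 + s * x) * indicator A x) \<partial>unit_lborel)"
  proof (rule integral_mono)
    show "?g x \<le> (1 - d / max 1 (1 + s)) * (1 / (1 + s * x) * indicator A x)"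
      if "x \<in> space unit_lborel" for x
      using weight_ratio_le[OF d, of x] that by (auto simp: indicator_def)
  qed (intro integrable_slope_weight[OF A] integrable_mult_right integrable_inverse_weight_indicator[OF A])+
  finally show ?thesis by (simp only: integral_mult_right_zero)
qed

end

lemma no_acim_if_gap:
  assumes gap: "a * c + b * (1 - c) < 1"
  shows "\<not> (\<exists>\<mu>. acim f \<mu>)"
proof
  assume "\<exists>\<mu>. acim f \<mu>"
  then obtain \<mu> where \<mu>: "acim f \<mu>" ..
  obtain h where h: "integrable unit_lborel h" "\<forall>x. 0 \<le> h x" "(\<integral>x. h x \<partial>unit_lborel) = (1::real)"
    and "\<mu> = density unit_lborel (\<lambda>x. ennreal (h x))"
    and inv: "weakly_invariant f h"
    using acim_density[OF measurable_f \<mu>] by blast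
  obtain s where s: "-1 < s" "a - 1 - s * (1 - a * c) < 0" "b - 1 + s * b * c < 0"
    using gap_weight[OF gap] .
  define d where "d = min (- (a - 1 - s * (1 - a * c))) (- (b - 1 + s * b * c))"
  have d: "a - 1 - s * (1 - a * c) \<le> - d" "b - 1 + s * b * c \<le> - d" "0 < d"
    using s by (auto simp: d_def)
  define q where "q = 1 - d / max 1 (1 + s)"
  have q1: "q < 1" using d by (simp add: q_def)
  \<comment> \<open>\<open>q\<close> dominates the relative derivative at 0, which is
    positive.\<close>
  have q0: "0 \<le> q"
  proof -
    have f0: "f 0 \<in> {0..1}" using f_in_unit by simp
    have "0 < slope 0 / (1 + s * f 0)"
      using weight_pos(1)[OF s(1) f0] slope_pos[of 0] by simp
    also have "\<dots> \<le> q"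
      using weight_ratio_le[OF s(1) d(1,2), of 0] d(3) by (simp add: q_def)
    finally show ?thesis by simp
  qed
  define A where "A n = (transfer_support ^^ n) {0..1}" for n
  have A [measurable]: "A n \<in> sets unit_lborel" for n
    by (induction n) (use transfer_support_measurable in \<open>auto simp: A_def\<close>)
  have int_A: "integrable unit_lborel (\<lambda>x. h x * indicator (A n) x)" for n
    using indicator_test_function[OF A] by (intro integrable_mult_bounded h) auto
  have mass: "(\<integral>x. h x * indicator (A n) x \<partial>unit_lborel) = 1" for n
  proof (induction n)
    case 0
    have "(\<integral>x. h x * indicator (A 0) x \<partial>unit_lborel) = (\<integral>x. h x \<partial>unit_lborel)"
      by (intro Bochner_Integration.integral_cong) (auto simp: A_def)
    then show ?case using h by simp
  next
    case (Suc n)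
    \<comment> \<open>\<open>f\<close> maps \<open>A n\<close> into \<open>A (Suc n)\<close>, so
      composing with \<open>f\<close> can only increase the mass; invariance then removes the
      composition.\<close>
    have "1 \<le> (\<integral>x. h x * indicator (A (Suc n)) (f x) \<partial>unit_lborel)"
      unfolding Suc[symmetric]
    proof (rule integral_mono[OF int_A])
      show "integrable unit_lborel (\<lambda>x. h x * indicator (A (Suc n)) (f x))"
        by (intro integrable_mult_bounded h) (auto simp: indicator_def)
      show "h x * indicator (A n) x \<le> h x * indicator (A (Suc n)) (f x)" if "x \<in> space unit_lborel" for x
        using image_in_transfer_support[of x "A n"] that h(2)[rule_format, of x]
        by (auto simp: indicator_def A_def)
    qed
    also have "\<dots> = (\<integral>x. h x * indicator (A (Suc n)) x \<partial>unit_lborel)"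
      by (rule weakly_invariantD[OF inv]) (use indicator_test_function[OF A] in auto)
    finally have "1 \<le> \<dots>" .
    moreover have "\<dots> \<le> (\<integral>x. h x \<partial>unit_lborel)"
      using int_A h by (intro integral_mono) (auto simp: indicator_def)
    ultimately show ?case using h by linarith
  qed
  have small: "(\<integral>x. 1 / (1 + s * x) * indicator (A n) x \<partial>unit_lborel) \<le>
      q ^ n * (\<integral>x. 1 / (1 + s * x) * indicator (A 0) x \<partial>unit_lborel)" for n
  proof (induction n)
    case (Suc n)
    have "(\<integral>x. 1 / (1 + s * x) * indicator (A (Suc n)) x \<partial>unit_lborel) \<le>
        q * (\<integral>x. 1 / (1 + s * x) * indicator (A n) x \<partial>unit_lborel)"
      using transfer_support_contracts[OF s(1) gap A d(1,2)] d(3) by (simp add: A_def q_def)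
    also have "\<dots> \<le> q * (q ^ n * (\<integral>x. 1 / (1 + s * x) * indicator (A 0) x \<partial>unit_lborel))"
      using Suc q0 by (intro mult_left_mono) auto
    finally show ?case by simp
  qed simp
  \<comment> \<open>\<open>h\<close> need not be bounded by a multiple of the weight, so smallness
    of \<open>A n\<close> says nothing about its mass under \<open>h\<close>. The intersection is a
    genuine null set, and still carries all the mass.\<close>
  let ?B = "\<Inter>n. A n"
  have B: "?B \<in> sets unit_lborel" by measurable
  have pos: "0 \<le> 1 / (1 + s * x) * indicator C x" if "x \<in> {0..1}" for x and C :: "real set"
    using weight_pos(1)[OF s(1) that] by simp
  have "(\<integral>x. 1 / (1 + s * x) * indicator ?B x \<partial>unit_lborel) \<le> 0"
  proof (rule LIMSEQ_le_const)
    have "(\<lambda>n. q ^ n * (\<integral>x. 1 / (1 + s * x) * indicator (A 0) x \<partial>unit_lborel)) \<longlonglongrightarrow>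
        0 * (\<integral>x. 1 / (1 + s * x) * indicator (A 0) x \<partial>unit_lborel)"
      using q0 q1 by (intro tendsto_mult LIMSEQ_realpow_zero tendsto_const) auto
    then show "(\<lambda>n. q ^ n * (\<integral>x. 1 / (1 + s * x) * indicator (A 0) x \<partial>unit_lborel)) \<longlonglongrightarrow> 0"
      by simp
    have "(\<integral>x. 1 / (1 + s * x) * indicator ?B x \<partial>unit_lborel) \<le>
        (\<integral>x. 1 / (1 + s * x) * indicator (A n) x \<partial>unit_lborel)" for n
    proof (intro integral_mono integrable_inverse_weight_indicator s A B)
      show "1 / (1 + s * x) * indicator ?B x \<le> 1 / (1 + s * x) * indicator (A n) x"
        if "x \<in> space unit_lborel" for x
        using pos[of x "A n"] that by (auto simp: indicator_def)
    qed
    then show "\<exists>N. \<forall>n\<ge>N. (\<integral>x. 1 / (1 + s * x) * indicator ?B x \<partial>unit_lborel) \<le>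
        q ^ n * (\<integral>x. 1 / (1 + s * x) * indicator (A 0) x \<partial>unit_lborel)"
      using small order_trans by blast
  qed
  moreover have nonneg: "AE x in unit_lborel. 0 \<le> 1 / (1 + s * x) * indicator ?B x"
    using pos by (intro AE_I2) simp
  ultimately have "(\<integral>x. 1 / (1 + s * x) * indicator ?B x \<partial>unit_lborel) = 0"
    using integral_nonneg_AE[OF nonneg] by linarith
  then have "AE x in unit_lborel. 1 / (1 + s * x) * indicator ?B x = 0"
    using integral_nonneg_eq_0_iff_AE[OF integrable_inverse_weight_indicator[OF s(1) B] nonneg] by simp
  then have notB: "AE x in unit_lborel. x \<notin> ?B"
    using AE_space
  proof eventually_elim
    case (elim x)
    then show ?case using weight_pos(1)[OF s(1), of x] by (auto simp: indicator_eq_0_iff)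
  qed
  have "AE x in unit_lborel. h x - h x * indicator (A n) x = 0" for n
  proof (rule integral_nonneg_eq_0_iff_AE[THEN iffD1])
    show "integrable unit_lborel (\<lambda>x. h x - h x * indicator (A n) x)"
      using h int_A by auto
    show "AE x in unit_lborel. 0 \<le> h x - h x * indicator (A n) x"
      using h by (intro AE_I2) (auto simp: indicator_def)
    show "(\<integral>x. h x - h x * indicator (A n) x \<partial>unit_lborel) = 0"
      using h int_A mass by (subst Bochner_Integration.integral_diff) auto
  qed
  then have "AE x in unit_lborel. \<forall>n. h x - h x * indicator (A n) x = 0"
    by (intro AE_all_countable[THEN iffD2] allI)
  with notB have "AE x in unit_lborel. h x = 0"
    by eventually_elim (auto simp: indicator_def split: if_splits)
  then have "(\<integral>x. h x \<partial>unit_lborel) = 0"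
    by (rule integral_eq_zero_AE)
  then show False using h by simp
qed

end

section \<open>The isometric case\<close>

text \<open>The set where \<open>h\<close> is negative is the decisive test. Used where positivity
  is known only in integrated form, through duality or a limit.\<close>

lemma AE_nonneg_if_integrals_nonneg:
  fixes h :: "real \<Rightarrow> real"
  assumes h: "integrable unit_lborel h"
    and nonneg: "\<And>B. B \<in> sets unit_lborel \<Longrightarrow> 0 \<le> (\<integral>x. h x * indicator B x \<partial>unit_lborel)"
  shows "AE x in unit_lborel. 0 \<le> h x"
proof -
  let ?B = "{x \<in> space unit_lborel. h x < 0}"
  have B: "?B \<in> sets unit_lborel" using h by measurable
  have int: "integrable unit_lborel (\<lambda>x. - (h x * indicator ?B x))"
    using indicator_test_function[OF B] by (intro Bochner_Integration.integrable_minus integrable_mult_bounded h) auto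
  have pos: "AE x in unit_lborel. 0 \<le> - (h x * indicator ?B x)"
    by (intro AE_I2) (auto simp: indicator_def)
  have "(\<integral>x. - (h x * indicator ?B x) \<partial>unit_lborel) \<le> 0"
    using nonneg[OF B] by simp
  then have "(\<integral>x. - (h x * indicator ?B x) \<partial>unit_lborel) = 0"
    using integral_nonneg_AE[OF pos] by linarith
  then have "AE x in unit_lborel. - (h x * indicator ?B x) = 0"
    using integral_nonneg_eq_0_iff_AE[OF int pos] by blast
  then show ?thesis
    using AE_space by eventually_elim (auto simp: indicator_def split: if_splits)
qed

text \<open>Transfers uniqueness by distribution functions, which lives on the real line, back to
  measures on [0,1].\<close>

lemma distr_unit_eqD:
  assumes "sets M = sets unit_lborel" "sets N = sets unit_lborel"
    and eq: "distr M borel (\<lambda>x. x) = distr N borel (\<lambda>x::real. x)"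
  shows "M = N"
proof (rule measure_eqI)
  fix B assume B: "B \<in> sets M"
  have m: "(\<lambda>x. x) \<in> measurable M borel" "(\<lambda>x. x) \<in> measurable N borel"
    using borel_measurable_unit_lborelI[of "\<lambda>x. x"]
    unfolding measurable_cong_sets[OF assms(1) refl] measurable_cong_sets[OF assms(2) refl] by auto
  have B': "B \<in> sets borel" "B \<subseteq> {0..1}"
    using B assms(1) by (auto simp: sets_unit_lborel sets_restrict_space)
  have sp: "space M = {0..1}" "space N = {0..1}"
    using sets_eq_imp_space_eq[OF assms(1)] sets_eq_imp_space_eq[OF assms(2)] by auto
  have "emeasure M B = emeasure (distr M borel (\<lambda>x. x)) B"
    using m B' sp by (subst emeasure_distr) (auto intro!: arg_cong2[where f=emeasure])
  also have "\<dots> = emeasure N B"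
    unfolding eq using m B' sp by (subst emeasure_distr) (auto intro!: arg_cong2[where f=emeasure])
  finally show "emeasure M B = emeasure N B" .
qed (use assms in simp)

context lorenz
begin

lemma integral_funpow_frobenius_perron:
  fixes g \<psi> :: "real \<Rightarrow> real"
  assumes g: "integrable unit_lborel g"
    and \<psi>: "\<psi> \<in> borel_measurable unit_lborel" "\<And>x. x \<in> {0..1} \<Longrightarrow> \<bar>\<psi> x\<bar> \<le> 1"
  shows "integrable unit_lborel ((P ^^ n) g)"
    and "(\<integral>x. (P ^^ n) g x * \<psi> x \<partial>unit_lborel) = (\<integral>x. g x * \<psi> ((f ^^ n) x) \<partial>unit_lborel)"
proof -
  show int: "integrable unit_lborel ((P ^^ n) g)" for n
    by (induction n) (use g integrable_frobenius_perron in auto)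
  show "(\<integral>x. (P ^^ n) g x * \<psi> x \<partial>unit_lborel) = (\<integral>x. g x * \<psi> ((f ^^ n) x) \<partial>unit_lborel)"
    using \<psi>
  proof (induction n arbitrary: \<psi>)
    case (Suc n)
    have "(\<integral>x. (P ^^ Suc n) g x * \<psi> x \<partial>unit_lborel) = (\<integral>x. P ((P ^^ n) g) x * \<psi> x \<partial>unit_lborel)"
      by simp
    also have "\<dots> = (\<integral>x. (P ^^ n) g x * \<psi> (f x) \<partial>unit_lborel)"
      using Suc.prems by (intro frobenius_perron_dual int) auto
    also have "\<dots> = (\<integral>x. g x * \<psi> (f ((f ^^ n) x)) \<partial>unit_lborel)"
      using Suc.prems f_in_unit
      by (intro Suc.IH[of "\<lambda>x. \<psi> (f x)"] measurable_compose[OF measurable_f]) auto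
    finally show ?case by simp
  qed simp
qed

end

section \<open>Criticality: an explicit invariant density\<close>

locale critical_lorenz = lorenz +
  assumes crit: "a * c + b * (1 - c) = 1"
begin

text \<open>At s = a / b - 1 both branch constants vanish, so along each branch
  \<open>weight\<close> is multiplied exactly by the slope.\<close>

definition weight :: "real \<Rightarrow> real" where
  "weight x = 1 + (a / b - 1) * x"

lemma ratio_gt: "-1 < a / b - 1"
  using a_pos b_pos by simp

lemma weight_cocycle_left: "weight (a * x + 1 - a * c) = a * weight x"
proof -
  have "(a / b - 1) * (1 - a * c) = (a - b) * (1 - c)"
  proof -
    have "1 - a * c = b * (1 - c)" using crit by simp
    then show ?thesis using b_pos by (simp only: mult.assoc[symmetric] left_diff_distrib) simp
  qed
  also have "\<dots> = a - 1" using crit by (simp add: algebra_simps)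
  finally show ?thesis by (simp add: weight_def algebra_simps)
qed

lemma weight_cocycle_right: "weight (b * (x - c)) = b * weight x"
proof -
  have "(a / b - 1) * (b * c) = a * c - b * c"
    using b_pos by (simp add: field_simps)
  also have "\<dots> = 1 - b" using crit by (simp add: algebra_simps)
  finally show ?thesis by (simp add: weight_def algebra_simps)
qed

lemma weight_bounds:
  assumes "x \<in> {0..1}"
  shows "0 < weight x" "min 1 (a / b) \<le> weight x" "weight x \<le> max 1 (a / b)"
  using weight_pos[OF ratio_gt assms] by (auto simp: weight_def)

text \<open>The branch images meet only in 1 - a c = b (1 - c). Off that point \<open>P\<close> has
  one term, and the cocycle relation returns 1 / \<open>weight\<close>.\<close>

lemma weakly_invariant_inverse_weight: "weakly_invariant f (\<lambda>x. 1 / weight x)"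
proof (rule P_eq_imp_invariant)
  show "integrable unit_lborel (\<lambda>x. 1 / weight x)"
    using integrable_inverse_weight[OF ratio_gt] by (simp add: weight_def)
  have ne: "AE y in unit_lborel. y \<noteq> 1 - a * c"
    by (rule AE_unit_lborel_neq)
  have *: "P (\<lambda>x. 1 / weight x) y = 1 / weight y" if y: "y \<in> {0..1}" "y \<noteq> 1 - a * c" for y
  proof (cases "y < 1 - a * c")
    case True
    have "b * weight ((y + b * c) / b) = weight (b * ((y + b * c) / b - c))"
      by (rule weight_cocycle_right[symmetric])
    also have "b * ((y + b * c) / b - c) = y"
      using b_pos by (simp add: right_diff_distrib)
    finally have "b * weight ((y + b * c) / b) = weight y" .
    moreover have "P (\<lambda>x. 1 / weight x) y = 1 / (b * weight ((y + b * c) / b))"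
      using True y crit by (auto simp: frobenius_perron_def)
    ultimately show ?thesis by simp
  next
    case False
    have "a * weight ((y - (1 - a * c)) / a) = weight (a * ((y - (1 - a * c)) / a) + 1 - a * c)"
      by (rule weight_cocycle_left[symmetric])
    also have "a * ((y - (1 - a * c)) / a) + 1 - a * c = y"
      using a_pos by simp
    finally have "a * weight ((y - (1 - a * c)) / a) = weight y" .
    moreover have "P (\<lambda>x. 1 / weight x) y = 1 / (a * weight ((y - (1 - a * c)) / a))"
      using False y crit by (auto simp: frobenius_perron_def)
    ultimately show ?thesis by simp
  qed
  show "AE y in unit_lborel. P (\<lambda>x. 1 / weight x) y = 1 / weight y"
    using ne AE_space by eventually_elim (use * in auto)
qed

text \<open>Covers \<open>(a, b) = (1, 1)\<close> too, where \<open>weight\<close> is constant. The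
  bounds on \<open>K\<close> later yield the pointwise bounds on the normalized density.\<close>

lemma acim_inverse_weight:
  defines "K \<equiv> \<integral>x. 1 / weight x \<partial>unit_lborel"
  shows "1 / max 1 (a / b) \<le> K" "K \<le> 1 / min 1 (a / b)"
    "acim f (density unit_lborel (\<lambda>x. ennreal (1 / weight x / K)))"
proof -
  have int: "integrable unit_lborel (\<lambda>x. 1 / weight x)"
    using integrable_inverse_weight[OF ratio_gt] by (simp add: weight_def)
  have m: "0 < min 1 (a / b)" using a_pos b_pos by simp
  have lo: "1 / max 1 (a / b) \<le> 1 / weight x" if "x \<in> {0..1}" for x
    using weight_bounds[OF that] m by (intro divide_left_mono mult_pos_pos) auto
  have hi: "1 / weight x \<le> 1 / min 1 (a / b)" if "x \<in> {0..1}" for x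
    using weight_bounds[OF that] m by (intro divide_left_mono mult_pos_pos) auto
  have const: "(\<integral>x. k \<partial>unit_lborel) = k" for k :: real
    using unit_lborel.prob_space by simp
  have "(\<integral>x. 1 / max 1 (a / b) \<partial>unit_lborel) \<le> K"
    unfolding K_def using int lo by (intro integral_mono) auto
  then show K1: "1 / max 1 (a / b) \<le> K" by (simp only: const)
  have "K \<le> (\<integral>x. 1 / min 1 (a / b) \<partial>unit_lborel)"
    unfolding K_def using int hi by (intro integral_mono) auto
  then show "K \<le> 1 / min 1 (a / b)" by (simp only: const)
  have "0 < 1 / max 1 (a / b)" by simp
  with K1 have K: "0 < K" by linarith
  show "acim f (density unit_lborel (\<lambda>x. ennreal (1 / weight x / K)))"
  proof (rule acimI[OF measurable_f])
    show "integrable unit_lborel (\<lambda>x. 1 / weight x / K)"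
      using int by (rule integrable_divide_zero)
    show "AE x in unit_lborel. 0 \<le> 1 / weight x / K"
      using weight_bounds K by (intro AE_I2) (auto simp: less_imp_le)
    show "(\<integral>x. 1 / weight x / K \<partial>unit_lborel) = 1"
      using K by (simp only: integral_divide_zero K_def[symmetric]) simp
    show "weakly_invariant f (\<lambda>x. 1 / weight x / K)"
      by (intro weakly_invariant_divide weakly_invariant_inverse_weight)
  qed
qed

end

section \<open>Conjugacy with a rotation; rational angle\<close>

locale nonrigid_critical_lorenz = critical_lorenz +
  assumes nontriv: "(a, b) \<noteq> (1, 1)"
begin

text \<open>The integral of 1 / \<open>weight\<close> over [0,x] divided by that over [0,1]; the
  common factor 1 / (a / b - 1) cancels.\<close>

definition chart :: "real \<Rightarrow> real" where
  "chart x = ln (weight x) / ln (a / b)"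

definition rot :: real where
  "rot = ln a / ln (a / b)"

lemma a_ne_b: "a \<noteq> b"
  using crit nontriv by (auto simp: algebra_simps)

lemma ln_ratio_ne_0: "ln (a / b) \<noteq> 0"
  using a_ne_b a_pos b_pos by simp

lemma chart_0: "chart 0 = 0"
  by (simp add: chart_def weight_def)

lemma chart_1: "chart 1 = 1"
  using ln_ratio_ne_0 by (simp add: chart_def weight_def)

text \<open>For a < b both the numerator is decreasing and the denominator negative, so the quotient
  increases on either side of a = b.\<close>

lemma chart_strict_mono:
  assumes "0 \<le> x" "x < y" "y \<le> 1"
  shows "chart x < chart y"
proof -
  have diff: "weight y - weight x = (a / b - 1) * (y - x)"
    unfolding weight_def by (simp only: right_diff_distrib add_diff_cancel_left)
  show ?thesis
  proof (cases "a < b")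
    case True
    then have "a / b < 1" using b_pos by simp
    then have "(a / b - 1) * (y - x) < 0" using assms by (intro mult_neg_pos) auto
    then have "ln (a / b) < 0" "weight y < weight x"
      using a_pos b_pos \<open>a / b < 1\<close> diff by (simp, linarith)
    then show ?thesis
      using weight_bounds(1)[of x] weight_bounds(1)[of y] assms
      by (simp add: chart_def divide_strict_right_mono_neg)
  next
    case False
    then have "1 < a / b" using b_pos a_ne_b by simp
    then have "0 < (a / b - 1) * (y - x)" using assms by (intro mult_pos_pos) auto
    then have "0 < ln (a / b)" "weight x < weight y"
      using \<open>1 < a / b\<close> diff by (simp, linarith)
    then show ?thesis
      using weight_bounds(1)[of x] weight_bounds(1)[of y] assms
      by (simp add: chart_def divide_strict_right_mono)
  qed
qed

lemma chart_less_iff: "x \<in> {0..1} \<Longrightarrow> y \<in> {0..1} \<Longrightarrow> chart x < chart y \<longleftrightarrow> x < y"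
  using chart_strict_mono[of x y] chart_strict_mono[of y x]
  by (cases x y rule: linorder_cases) auto

lemma chart_le_iff: "x \<in> {0..1} \<Longrightarrow> y \<in> {0..1} \<Longrightarrow> chart x \<le> chart y \<longleftrightarrow> x \<le> y"
  using chart_less_iff[of y x] by (simp flip: not_less)

lemma chart_eq_iff: "x \<in> {0..1} \<Longrightarrow> y \<in> {0..1} \<Longrightarrow> chart x = chart y \<longleftrightarrow> x = y"
  using chart_le_iff[of x y] chart_le_iff[of y x] by (auto simp: eq_iff)

lemma chart_in_unit: "x \<in> {0..1} \<Longrightarrow> chart x \<in> {0..1}"
  using chart_le_iff[of 0 x] chart_le_iff[of x 1] by (simp add: chart_0 chart_1)

lemma chart_f_left:
  assumes "x \<in> {0..1}" "x < c"
  shows "chart (f x) = chart x + rot"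
  using assms weight_bounds(1)[OF assms(1)] a_pos
  by (simp add: chart_def rot_def f_left weight_cocycle_left ln_mult add_divide_distrib)

text \<open>The translations of the two branches differ by exactly 1, hence agree on the
  circle.\<close>

lemma ln_b_eq: "ln b / ln (a / b) = rot - 1"
  using ln_ratio_ne_0 a_pos b_pos by (simp add: rot_def ln_div field_simps)

lemma chart_f_right:
  assumes "x \<in> {0..1}" "c \<le> x"
  shows "chart (f x) = chart x + rot - 1"
  using assms weight_bounds(1)[OF assms(1)] b_pos ln_b_eq
  by (simp add: chart_def f_right weight_cocycle_right ln_mult add_divide_distrib)

lemma chart_c: "chart c = 1 - rot"
  using chart_f_right[of c] c_pos c_less_1 by (simp add: f_right chart_0)

lemma rot_bounds: "0 < rot" "rot < 1"
proof -
  have "0 < chart c" "chart c < 1"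
    using chart_less_iff[of 0 c] chart_less_iff[of c 1] c_pos c_less_1 by (auto simp: chart_0 chart_1)
  then show "0 < rot" "rot < 1" by (auto simp: chart_c)
qed

lemma ln_b_ne_0: "ln b \<noteq> 0"
  using ln_b_eq rot_bounds by auto

text \<open>With q = ln a / ln b one has rot = q / (q - 1) and q = rot / (rot - 1), an involution
  with rational coefficients.\<close>

lemma rot_rational_iff: "rot \<in> \<rat> \<longleftrightarrow> ln a / ln b \<in> \<rat>"
proof -
  have ne: "ln a - ln b \<noteq> 0" using ln_ratio_ne_0 a_pos b_pos by (simp add: ln_div)
  have "ln a / ln b - 1 = (ln a - ln b) / ln b"
    using ln_b_ne_0 by (simp add: diff_divide_distrib)
  then have 1: "rot = (ln a / ln b) / (ln a / ln b - 1)"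
    using ln_b_ne_0 ne a_pos b_pos by (simp add: rot_def ln_div)
  have 2: "ln a / ln b = rot / (rot - 1)"
    using ln_b_eq[symmetric] ln_ratio_ne_0 by (simp add: rot_def)
  show ?thesis
    using Rats_divide[of "ln a / ln b" "ln a / ln b - 1"] Rats_divide[of rot "rot - 1"]
      Rats_diff[OF _ Rats_1]
    unfolding 1[symmetric] 2[symmetric] by blast
qed

lemma chart_funpow:
  assumes "x \<in> {0..1}"
  shows "\<exists>k::int. chart ((f ^^ n) x) = chart x + real n * rot - of_int k"
proof (induction n)
  case 0
  show ?case by (intro exI[of _ 0]) simp
next
  case (Suc n)
  then obtain k :: int where k: "chart ((f ^^ n) x) = chart x + real n * rot - of_int k" ..
  have y: "(f ^^ n) x \<in> {0..1}" using funpow_f_in_unit[OF assms] .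
  show ?case
  proof (cases "(f ^^ n) x < c")
    case True
    then show ?thesis
      using chart_f_left[OF y] k by (intro exI[of _ k]) (simp add: algebra_simps)
  next
    case False
    then show ?thesis
      using chart_f_right[OF y] k by (intro exI[of _ "k + 1"]) (simp add: algebra_simps)
  qed
qed

text \<open>If rot = p / n, then n steps change the chart by an integer. Charts lie in [0,1], so
  this integer is 0, giving the same point, or 1 or -1, which happens only between the two
  endpoints.\<close>

lemma rational_rotation_period:
  assumes "ln a / ln b \<in> \<rat>"
  obtains n where "n > 0" "\<And>x. x \<in> {0..1} \<Longrightarrow> (x, (f ^^ n) x) \<in> circle_rel"
proof -
  have "rot \<in> \<rat>" using assms by (simp add: rot_rational_iff)
  then obtain p :: int and n :: nat where n: "n > 0" "rot = of_int p / of_nat n"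
    by (metis Rats_cases' of_int_of_nat_eq zero_less_imp_eq_int of_nat_0_less_iff)
  have "(x, (f ^^ n) x) \<in> circle_rel" if x: "x \<in> {0..1}" for x
  proof -
    have y: "(f ^^ n) x \<in> {0..1}" using funpow_f_in_unit[OF x] .
    obtain k :: int where "chart ((f ^^ n) x) = chart x + real n * rot - of_int k"
      using chart_funpow[OF x] by blast
    then have k: "chart ((f ^^ n) x) - chart x = of_int (p - k)"
      using n by simp
    have "\<bar>chart ((f ^^ n) x) - chart x\<bar> \<le> 1"
      using chart_in_unit[OF x] chart_in_unit[OF y] by auto
    then have "\<bar>p - k\<bar> \<le> 1" unfolding k by linarith
    then consider "p - k = 0" | "p - k = 1" | "p - k = -1" by linarith
    then show ?thesis
    proof cases
      case 1
      then show ?thesis using k chart_eq_iff[OF y x] x by (simp add: circle_rel_def)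
    next
      case 2
      then have "chart ((f ^^ n) x) = chart 1" "chart x = chart 0"
        using k chart_in_unit[OF x] chart_in_unit[OF y] by (auto simp: chart_0 chart_1)
      then show ?thesis using chart_eq_iff[OF y, of 1] chart_eq_iff[OF x, of 0] by (simp add: circle_rel_def)
    next
      case 3
      then have "chart ((f ^^ n) x) = chart 0" "chart x = chart 1"
        using k chart_in_unit[OF x] chart_in_unit[OF y] by (auto simp: chart_0 chart_1)
      then show ?thesis using chart_eq_iff[OF y, of 0] chart_eq_iff[OF x, of 1]
        by (auto simp: circle_rel_def)
    qed
  qed
  then show ?thesis using n that by blast
qed

lemma circle_map_funpow_class:
  assumes "x \<in> {0..1}"
  shows "(circle_map f ^^ n) (circle_rel `` {x}) = circle_rel `` {(f ^^ n) x}"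
  by (induction n)
     (use circle_map_class[OF c_pos c_less_1 crit] funpow_f_in_unit[OF assms] in auto)

text \<open>Off the endpoints \<open>circle_rel\<close> is equality, so f^n is the identity almost
  everywhere, and composing with \<open>f\<close> permutes the n terms of the mean
  cyclically.\<close>

lemma periodic_imp_acim_cesaro:
  assumes n: "n > 0" and per: "\<And>x. x \<in> {0..1} \<Longrightarrow> (x, (f ^^ n) x) \<in> circle_rel"
    and g: "prob_density g"
  shows "acim f (density unit_lborel (\<lambda>x. ennreal (cesaro_mean a b c n g x)))"
    and "has_density (density unit_lborel (\<lambda>x. ennreal (cesaro_mean a b c n g x))) (cesaro_mean a b c n g)"
proof -
  let ?A = "cesaro_mean a b c n g"
  have g: "integrable unit_lborel g" "AE x in unit_lborel. 0 \<le> g x" "(\<integral>x. g x \<partial>unit_lborel) = 1"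
    using g by (auto simp: prob_density_def)
  note int_i = integral_funpow_frobenius_perron(1)[OF g(1), of "\<lambda>_. 1", simplified]
  have A_int: "integrable unit_lborel ?A"
    unfolding cesaro_mean_def[abs_def] using int_i by (intro integrable_mult_right Bochner_Integration.integrable_sum)
  have A_dual: "(\<integral>x. ?A x * \<psi> x \<partial>unit_lborel) =
      (1 / real n) * (\<Sum>i<n. \<integral>x. g x * \<psi> ((f ^^ i) x) \<partial>unit_lborel)"
    if \<psi>: "\<psi> \<in> borel_measurable unit_lborel" "\<And>x. x \<in> {0..1} \<Longrightarrow> \<bar>\<psi> x\<bar> \<le> 1" for \<psi>
  proof -
    have "(\<integral>x. ?A x * \<psi> x \<partial>unit_lborel) =
        (\<integral>x. (1 / real n) * (\<Sum>i<n. (P ^^ i) g x * \<psi> x) \<partial>unit_lborel)"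
      by (simp add: cesaro_mean_def sum_distrib_right)
    also have "\<dots> = (1 / real n) * (\<Sum>i<n. \<integral>x. (P ^^ i) g x * \<psi> x \<partial>unit_lborel)"
      using int_i \<psi>
      by (subst integral_mult_right_zero, subst Bochner_Integration.integral_sum)
         (auto intro: integrable_mult_bounded)
    also have "\<dots> = (1 / real n) * (\<Sum>i<n. \<integral>x. g x * \<psi> ((f ^^ i) x) \<partial>unit_lborel)"
      using integral_funpow_frobenius_perron(2)[OF g(1) \<psi>] by simp
    finally show ?thesis .
  qed
  have ne: "AE x in unit_lborel. x \<noteq> 0 \<and> x \<noteq> 1"
    using AE_unit_lborel_neq[of 0] AE_unit_lborel_neq[of 1] by eventually_elim simp
  have fix_n: "AE x in unit_lborel. (f ^^ n) x = x"
    using ne AE_space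
  proof eventually_elim
    case (elim x)
    then show ?case using per[of x] by (auto simp: circle_rel_def doubleton_eq_iff)
  qed
  have A_inv: "weakly_invariant f ?A"
  proof (rule weakly_invariantI)
    fix \<psi> :: "real \<Rightarrow> real"
    assume \<psi>: "\<psi> \<in> borel_measurable unit_lborel" "\<And>x. x \<in> {0..1} \<Longrightarrow> \<bar>\<psi> x\<bar> \<le> 1"
    have [measurable]: "\<psi> \<in> borel_measurable unit_lborel" "g \<in> borel_measurable unit_lborel"
      using \<psi> g by auto
    let ?I = "\<lambda>i. \<integral>x. g x * \<psi> ((f ^^ i) x) \<partial>unit_lborel"
    have "(\<integral>x. ?A x * \<psi> (f x) \<partial>unit_lborel) =
        (1 / real n) * (\<Sum>i<n. \<integral>x. g x * \<psi> (f ((f ^^ i) x)) \<partial>unit_lborel)"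
      using \<psi> f_in_unit by (intro A_dual[of "\<lambda>x. \<psi> (f x)"] measurable_compose[OF measurable_f]) auto
    also have "(\<Sum>i<n. \<integral>x. g x * \<psi> (f ((f ^^ i) x)) \<partial>unit_lborel) = (\<Sum>i<n. ?I (Suc i))"
      by simp
    also have "\<dots> = (\<Sum>i<n. ?I i) + (?I n - ?I 0)"
      using sum_lessThan_telescope[of ?I n] by (simp add: sum_subtractf)
    also have "?I n = ?I 0"
    proof (rule integral_cong_AE)
      show "AE x in unit_lborel. g x * \<psi> ((f ^^ n) x) = g x * \<psi> ((f ^^ 0) x)"
        using fix_n by eventually_elim simp
    qed measurable
    also have "1 / real n * ((\<Sum>i<n. ?I i) + (?I 0 - ?I 0)) = (\<integral>x. ?A x * \<psi> x \<partial>unit_lborel)"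
      using A_dual[OF \<psi>] by simp
    finally show "(\<integral>x. ?A x * \<psi> (f x) \<partial>unit_lborel) = (\<integral>x. ?A x * \<psi> x \<partial>unit_lborel)" .
  qed
  \<comment> \<open>\<open>g\<close> is nonnegative only almost everywhere; integrating over sets by
    duality avoids following the exceptional set through the iterates of \<open>P\<close>.\<close>
  have A_nonneg: "AE x in unit_lborel. 0 \<le> ?A x"
  proof (rule AE_nonneg_if_integrals_nonneg[OF A_int])
    fix B assume B: "B \<in> sets unit_lborel"
    have "0 \<le> (\<integral>x. g x * indicator B ((f ^^ i) x) \<partial>unit_lborel)" for i
      using g(2) by (intro integral_nonneg_AE) (auto elim!: AE_mp)
    then show "0 \<le> (\<integral>x. ?A x * indicator B x \<partial>unit_lborel)"
      using indicator_test_function[OF B]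
      by (subst A_dual) (auto intro!: divide_nonneg_nonneg sum_nonneg)
  qed
  have "(\<integral>x. ?A x \<partial>unit_lborel) = 1"
    using A_dual[of "\<lambda>_. 1"] g(3) n by simp
  then show "acim f (density unit_lborel (\<lambda>x. ennreal (?A x)))"
    by (intro acimI measurable_f A_int A_nonneg A_inv)
  show "has_density (density unit_lborel (\<lambda>x. ennreal (?A x))) ?A"
    using A_int A_nonneg by (auto simp: has_density_def)
qed

end

section \<open>Irrational angle: uniqueness and bounds\<close>

context nonrigid_critical_lorenz
begin

lemma borel_measurable_chart: "chart \<in> borel_measurable borel"
  unfolding chart_def[abs_def] weight_def[abs_def] by measurable

lemma c_le_iff_chart: "x \<in> {0..1} \<Longrightarrow> c \<le> x \<longleftrightarrow> 1 - rot \<le> chart x"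
  using chart_le_iff[of c x] c_pos c_less_1 by (simp add: chart_c)

text \<open>In the chart the right branch covers [0, rot] and the left one [rot, 1). A level from
  rot on therefore contains the whole right branch; a lower level meets the right branch
  only.\<close>

lemma chart_f_le_iff:
  assumes "x \<in> {0..1}"
  shows "rot \<le> t \<Longrightarrow> t < 1 \<Longrightarrow> chart (f x) \<le> t \<longleftrightarrow> chart x \<le> t - rot \<or> c \<le> x"
    and "t < rot \<Longrightarrow> 0 \<le> t \<Longrightarrow> chart (f x) \<le> t \<longleftrightarrow> chart x \<le> t + 1 - rot \<and> c \<le> x"
  using chart_f_left[OF assms] chart_f_right[OF assms] c_le_iff_chart[OF assms] chart_in_unit[OF assms]
  by (cases "x < c"; fastforce)+

text \<open>It suffices to follow the orbit of 0 under the rotation: there F(t) - t grows by the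
  same amount at every step, boundedness forces this amount to be 0, and density of the orbit does
  the rest.\<close>

lemma acim_measure_chart:
  assumes irrational: "ln a / ln b \<notin> \<rat>" and \<mu>: "acim f \<mu>" and t: "t \<in> {0..1}"
  shows "cdf (distr \<mu> borel chart) t = t"
proof -
  interpret \<mu>: prob_space \<mu> using \<mu> by (simp add: acim_def)
  have sets: "sets \<mu> = sets unit_lborel" using \<mu> by (simp add: acim_def sets_unit_lborel)
  have space [simp]: "space \<mu> = {0..1}" using sets_eq_imp_space_eq[OF sets] by simp
  have ac: "absolutely_continuous unit_lborel \<mu>" using \<mu> by (simp add: acim_def)
  have f_meas [measurable]: "f \<in> measurable \<mu> \<mu>" and inv: "distr \<mu> \<mu> f = \<mu>"
    using \<mu> by (auto simp: acim_def invariant_measure_def)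
  have id_meas [measurable]: "(\<lambda>x. x) \<in> measurable \<mu> borel"
    using borel_measurable_unit_lborelI[of "\<lambda>x. x"] measurable_cong_sets[OF sets refl] by auto
  have chart_meas [measurable]: "chart \<in> measurable \<mu> borel"
    using measurable_compose[OF id_meas borel_measurable_chart] .
  define F where "F = cdf (distr \<mu> borel chart)"
  interpret F: real_distribution "distr \<mu> borel chart" by auto
  have F_eq: "F t = \<mu>.prob {x \<in> space \<mu>. chart x \<le> t}" for t
    unfolding F_def cdf_def by (subst measure_distr) (auto intro!: arg_cong[where f=\<mu>.prob])
  have F_f: "F t = \<mu>.prob {x \<in> space \<mu>. chart (f x) \<le> t}" for t
  proof -
    have "F t = measure (distr \<mu> \<mu> f) {x \<in> space \<mu>. chart x \<le> t}"
      by (simp only: F_eq inv)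
    also have "\<dots> = \<mu>.prob (f -` {x \<in> space \<mu>. chart x \<le> t} \<inter> space \<mu>)"
      by (rule measure_distr[OF f_meas]) measurable
    also have "f -` {x \<in> space \<mu>. chart x \<le> t} \<inter> space \<mu> = {x \<in> space \<mu>. chart (f x) \<le> t}"
      using measurable_space[OF f_meas] by blast
    finally show ?thesis .
  qed
  \<comment> \<open>Absolute continuity enters here: there are no atoms, so \<open>F\<close> is
    continuous, as the passage from a dense orbit to all of [0,1] requires.\<close>
  have null_point: "\<mu>.prob {x \<in> space \<mu>. chart x = t} = 0" for t
  proof -
    have "{x \<in> space \<mu>. chart x = t} \<in> null_sets unit_lborel"
    proof (cases "\<exists>y\<in>{0..1}. chart y = t")
      case True
      then obtain y where y: "y \<in> {0..1}" "chart y = t" by blast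
      then have "{x \<in> space \<mu>. chart x = t} = {y}" using chart_eq_iff by auto
      moreover have "{y} \<in> null_sets unit_lborel"
        using y by (simp add: unit_lborel_def null_sets_restrict_space finite_imp_null_set_lborel)
      ultimately show ?thesis by simp
    next
      case False
      then have "{x \<in> space \<mu>. chart x = t} = {}" by auto
      then show ?thesis by (simp only: null_sets.empty_sets)
    qed
    then have "{x \<in> space \<mu>. chart x = t} \<in> null_sets \<mu>"
      using ac by (auto simp: absolutely_continuous_def)
    then show ?thesis by (simp add: measure_def null_setsD1)
  qed
  have cont: "isCont F t" for t
  proof -
    have "measure (distr \<mu> borel chart) {t} = \<mu>.prob {x \<in> space \<mu>. chart x = t}"
      by (subst measure_distr) (auto intro!: arg_cong[where f=\<mu>.prob])
    then show ?thesis unfolding F_def F.isCont_cdf using null_point by simp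
  qed
  have F0: "F 0 = 0"
  proof -
    have "{x \<in> space \<mu>. chart x \<le> 0} = {x \<in> space \<mu>. chart x = 0}"
      using chart_in_unit by force
    then show ?thesis unfolding F_eq using null_point by simp
  qed
  define m where "m = \<mu>.prob {x \<in> space \<mu>. c \<le> x}"
  have m': "\<mu>.prob {x \<in> space \<mu>. x < c} = 1 - m"
  proof -
    have "{x \<in> space \<mu>. x < c} = space \<mu> - {x \<in> space \<mu>. c \<le> x}" by auto
    moreover have "{x \<in> space \<mu>. c \<le> x} \<in> sets \<mu>" by measurable
    ultimately show ?thesis unfolding m_def by (simp only: \<mu>.prob_compl)
  qed
  have F_upper: "F t = F (t - rot) + m" if "rot \<le> t" "t < 1" for t
  proof -
    have eq: "{x \<in> space \<mu>. chart (f x) \<le> t} = {x \<in> space \<mu>. chart x \<le> t - rot} \<union> {x \<in> space \<mu>. c \<le> x}"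
      using chart_f_le_iff(1) that by auto
    have disj: "{x \<in> space \<mu>. chart x \<le> t - rot} \<inter> {x \<in> space \<mu>. c \<le> x} = {}"
      using c_le_iff_chart that by fastforce
    have "\<mu>.prob {x \<in> space \<mu>. chart (f x) \<le> t} =
        \<mu>.prob {x \<in> space \<mu>. chart x \<le> t - rot} + \<mu>.prob {x \<in> space \<mu>. c \<le> x}"
      unfolding eq by (rule \<mu>.finite_measure_Union[OF _ _ disj]; measurable)
    then show ?thesis by (simp only: F_f[of t] F_eq[of "t - rot"] m_def)
  qed
  have F_lower: "F t = F (t + 1 - rot) - 1 + m" if "t < rot" "0 \<le> t" for t
  proof -
    have eq: "{x \<in> space \<mu>. chart x \<le> t + 1 - rot} = {x \<in> space \<mu>. chart (f x) \<le> t} \<union> {x \<in> space \<mu>. x < c}"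
      using chart_f_le_iff(2) that c_le_iff_chart by fastforce
    have disj: "{x \<in> space \<mu>. chart (f x) \<le> t} \<inter> {x \<in> space \<mu>. x < c} = {}"
      using chart_f_le_iff(2) that by fastforce
    have "\<mu>.prob {x \<in> space \<mu>. chart x \<le> t + 1 - rot} =
        \<mu>.prob {x \<in> space \<mu>. chart (f x) \<le> t} + \<mu>.prob {x \<in> space \<mu>. x < c}"
      unfolding eq by (rule \<mu>.finite_measure_Union[OF _ _ disj]; measurable)
    then show ?thesis by (simp only: F_f[of t] F_eq[of "t + 1 - rot"] m')
  qed
  \<comment> \<open>\<open>F_upper\<close> is the step without wrap-around of \<open>frac\<close>,
    \<open>F_lower\<close> the one with it. Both add \<open>m - rot\<close> to F(t) - t, starting
    from \<open>F 0 = 0\<close>.\<close>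
  have orbit: "F (frac (real n * rot)) - frac (real n * rot) = real n * (m - rot)" for n
  proof (induction n)
    case (Suc n)
    let ?\<theta> = "frac (real n * rot)"
    have rot: "frac rot = rot" using rot_bounds by (simp add: frac_eq)
    have fr: "frac (real (Suc n) * rot) = (if ?\<theta> + rot < 1 then ?\<theta> + rot else ?\<theta> + rot - 1)"
      using frac_add[of "real n * rot" rot] rot by (simp add: algebra_simps)
    have \<theta>: "0 \<le> ?\<theta>" "?\<theta> < 1" by (auto simp: frac_lt_1)
    show ?case
    proof (cases "?\<theta> + rot < 1")
      case True
      then have "F (?\<theta> + rot) = F ?\<theta> + m" using F_upper[of "?\<theta> + rot"] \<theta> by simp
      then show ?thesis unfolding fr using True Suc by (simp add: algebra_simps)
    next
      case False
      then have "F (?\<theta> + rot - 1) = F ?\<theta> - 1 + m" using F_lower[of "?\<theta> + rot - 1"] \<theta> by simp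
      then show ?thesis unfolding fr using False Suc by (simp add: algebra_simps)
    qed
  qed (simp add: F0)
  \<comment> \<open>\<open>F\<close> and \<open>frac\<close> take values in [0,1], so linear growth
    along the orbit must have rate 0.\<close>
  have "m = rot"
  proof (rule ccontr)
    assume "m \<noteq> rot"
    then obtain n where n: "2 < real n * \<bar>m - rot\<bar>"
      using reals_Archimedean3[of "\<bar>m - rot\<bar>"] by auto
    have "\<bar>F (frac (real n * rot)) - frac (real n * rot)\<bar> \<le> 1"
      using frac_ge_0[of "real n * rot"] frac_lt_1[of "real n * rot"]
        \<mu>.prob_le_1[of "{x \<in> space \<mu>. chart x \<le> frac (real n * rot)}"]
        measure_nonneg[of \<mu> "{x \<in> space \<mu>. chart x \<le> frac (real n * rot)}"]
      unfolding F_eq by linarith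
    then show False using n unfolding orbit by (simp add: abs_mult)
  qed
  then have "range (\<lambda>n. frac (real n * rot)) \<subseteq> {t. F t = t}"
    using orbit by auto
  moreover have "closed {t. F t = t}"
    using cont by (intro closed_Collect_eq continuous_at_imp_continuous_on) auto
  ultimately have "closure (range (\<lambda>n. frac (real n * rot))) \<subseteq> {t. F t = t}"
    by (rule closure_minimal)
  moreover have "rot \<notin> \<rat>" using irrational by (simp add: rot_rational_iff)
  ultimately show ?thesis
    using Kronecker_approx_1[of rot] t by (auto simp: F_def)
qed

text \<open>Since \<open>chart\<close> is increasing, the previous lemma at level
  \<open>chart x\<close> says that [0,x] has mass \<open>chart x\<close>, which fixes the
  distribution function.\<close>

lemma acim_unique_if_irrational:
  assumes irrational: "ln a / ln b \<notin> \<rat>" and \<mu>: "acim f \<mu>" and \<nu>: "acim f \<nu>"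
  shows "\<mu> = \<nu>"
proof -
  have sets: "sets \<mu> = sets unit_lborel" if "acim f \<mu>" for \<mu>
    using that by (simp add: acim_def sets_unit_lborel)
  have id_meas: "(\<lambda>x. x) \<in> measurable \<mu> borel" if "acim f \<mu>" for \<mu>
    using borel_measurable_unit_lborelI[of "\<lambda>x. x"] measurable_cong_sets[OF sets[OF that] refl] by auto
  have cdf: "cdf (distr \<mu> borel (\<lambda>x. x)) x = (if x < 0 then 0 else if x \<le> 1 then chart x else 1)"
    if \<mu>: "acim f \<mu>" for \<mu> x
  proof -
    interpret \<mu>: prob_space \<mu> using \<mu> by (simp add: acim_def)
    have space: "space \<mu> = {0..1}" using sets_eq_imp_space_eq[OF sets[OF \<mu>]] by simp
    have chart_meas: "chart \<in> measurable \<mu> borel"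
      using measurable_compose[OF id_meas[OF \<mu>] borel_measurable_chart] .
    have eq: "cdf (distr \<mu> borel (\<lambda>x. x)) x = \<mu>.prob {y \<in> space \<mu>. y \<le> x}"
      unfolding cdf_def using id_meas[OF \<mu>]
      by (subst measure_distr) (auto intro!: arg_cong[where f=\<mu>.prob])
    consider "x < 0" | "x \<in> {0..1}" | "1 < x" by fastforce
    then show ?thesis
    proof cases
      case 1
      then have "{y \<in> space \<mu>. y \<le> x} = {}" by (auto simp: space)
      then show ?thesis using 1 eq by (simp del: Collect_empty_eq)
    next
      case 2
      have "{y \<in> space \<mu>. y \<le> x} = {y \<in> space \<mu>. chart y \<le> chart x}"
        using chart_le_iff[OF _ 2] by (auto simp: space)
      moreover have "cdf (distr \<mu> borel chart) (chart x) = \<mu>.prob {y \<in> space \<mu>. chart y \<le> chart x}"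
        unfolding cdf_def using chart_meas
        by (subst measure_distr) (auto intro!: arg_cong[where f=\<mu>.prob])
      ultimately show ?thesis
        using 2 eq acim_measure_chart[OF irrational \<mu> chart_in_unit[OF 2]] by auto
    next
      case 3
      then have "{y \<in> space \<mu>. y \<le> x} = space \<mu>" by (auto simp: space)
      then show ?thesis using 3 eq by (simp add: \<mu>.prob_space)
    qed
  qed
  have "real_distribution (distr \<mu> borel (\<lambda>x. x))" if "acim f \<mu>" for \<mu>
    using that id_meas[OF that] by (intro prob_space.real_distribution_distr) (auto simp: acim_def)
  then have "distr \<mu> borel (\<lambda>x. x) = distr \<nu> borel (\<lambda>x. x)"
    using \<mu> \<nu> cdf by (intro cdf_unique ext) auto
  then show ?thesis
    using distr_unit_eqD[OF sets[OF \<mu>] sets[OF \<nu>]] by simp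
qed

text \<open>By uniqueness the density is 1 / (\<open>weight\<close> K), which lies between
  \<open>lo / hi\<close> and its inverse. With z = a / b, \<open>lo / hi\<close> is min z (1 / z),
  and \<open>r\<close> is its fourth power, hence not larger.\<close>

lemma irrational_acim_bounds:
  assumes irrational: "ln a / ln b \<notin> \<rat>" and \<mu>: "acim f \<mu>"
  defines "r \<equiv> min ((a / b) ^ 4) ((a / b) powi (- 4))"
  shows "\<exists>h. has_density \<mu> h \<and> (AE x in unit_lborel. r \<le> h x \<and> h x \<le> 1 / r)"
proof -
  define K where "K = (\<integral>x. 1 / weight x \<partial>unit_lborel)"
  define lo hi where "lo = min 1 (a / b)" and "hi = max 1 (a / b)"
  note K = acim_inverse_weight(1,2)[folded K_def lo_def hi_def]
  have z: "0 < a / b" using a_pos b_pos by simp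
  then have lohi: "0 < lo" "lo \<le> 1" "1 \<le> hi" by (auto simp: lo_def hi_def)
  have "0 < 1 / hi" using lohi by simp
  then have K0: "0 < K" using K by linarith
  have \<mu>_eq: "\<mu> = density unit_lborel (\<lambda>x. ennreal (1 / weight x / K))"
    using acim_unique_if_irrational[OF irrational \<mu> acim_inverse_weight(3)] by (simp add: K_def)
  have r: "0 < r" "r \<le> lo / hi"
  proof -
    show "0 < r" using a_pos b_pos by (simp add: r_def power_int_minus)
    show "r \<le> lo / hi"
    proof (cases "a / b \<le> 1")
      case True
      have "r \<le> (a / b) ^ 4" by (simp add: r_def)
      also have "\<dots> \<le> (a / b) ^ 1" using True z by (intro power_decreasing) auto
      finally show ?thesis using True by (simp add: lo_def hi_def)
    next
      case False
      have "r \<le> (1 / (a / b)) ^ 4"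
        by (simp add: r_def power_int_minus power_divide min_le_iff_disj inverse_eq_divide)
      also have "\<dots> \<le> (1 / (a / b)) ^ 1" using False a_pos b_pos by (intro power_decreasing) (auto simp: divide_le_eq le_divide_eq)
      finally show ?thesis using False by (simp add: lo_def hi_def)
    qed
  qed
  have bounds: "r \<le> 1 / weight x / K \<and> 1 / weight x / K \<le> 1 / r" if "x \<in> {0..1}" for x
  proof -
    have w: "0 < weight x" "lo \<le> weight x" "weight x \<le> hi"
      using weight_bounds[OF that] by (auto simp: lo_def hi_def)
    have "weight x * K \<le> hi * (1 / lo)"
      using w K K0 lohi by (intro mult_mono) auto
    then have 1: "lo / hi \<le> 1 / (weight x * K)"
      using w K0 lohi by (simp add: field_simps)
    have "lo * (1 / hi) \<le> weight x * K"
      using w K K0 lohi by (intro mult_mono) auto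
    then have "1 / (weight x * K) \<le> 1 / (lo / hi)"
      using w K0 lohi by (intro divide_left_mono) auto
    also have "\<dots> \<le> 1 / r"
      using r lohi by (intro divide_left_mono) auto
    finally show ?thesis using 1 r by simp
  qed
  have "has_density \<mu> (\<lambda>x. 1 / weight x / K)"
    unfolding has_density_def
  proof (intro conjI \<mu>_eq)
    show "(\<lambda>x. 1 / weight x / K) \<in> borel_measurable unit_lborel"
      unfolding weight_def[abs_def] by (intro borel_measurable_unit_lborelI) measurable
    show "AE x in unit_lborel. 0 \<le> 1 / weight x / K"
      using weight_bounds(1) K0 by (intro AE_I2) (auto simp: less_imp_le)
  qed
  moreover have "AE x in unit_lborel. r \<le> 1 / weight x / K \<and> 1 / weight x / K \<le> 1 / r"
    using bounds by (intro AE_I2) simp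
  ultimately show ?thesis by blast
qed

end

section \<open>The expanding case\<close>

locale overlapping_lorenz = lorenz +
  assumes overlap: "a * c + b * (1 - c) > 1"
begin

text \<open>The left-continuous version of the map avoids \<open>0\<close> on the orbit of \<open>1\<close>.\<close>

definition left_map :: "real \<Rightarrow> real" where
  "left_map t = (if t \<le> c then a * t + 1 - a * c else b * (t - c))"

definition left_slope :: "real \<Rightarrow> real" where
  "left_slope t = (if t \<le> c then a else b)"

definition inv_deriv :: "real \<Rightarrow> nat \<Rightarrow> real" where
  "inv_deriv t n = (\<Prod>i<n. 1 / left_slope ((left_map ^^ i) t))"

lemma left_slope_pos: "0 < left_slope t"
  using a_pos b_pos by (simp add: left_slope_def)

lemma left_map_in_unit:
  assumes "t \<in> {0..1}"
  shows "left_map t \<in> {0..1}"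
proof (cases "t \<le> c")
  case True
  then have "a * t \<le> a * c" "0 \<le> a * t"
    using a_pos assms by auto
  then show ?thesis using True ac_le_1 by (auto simp: left_map_def)
next
  case False
  then have "b * (t - c) \<le> b * (1 - c)" "0 \<le> b * (t - c)"
    using b_pos assms by auto
  then show ?thesis using False bc_le_1 by (auto simp: left_map_def)
qed

lemma left_orbit_in_unit: "t \<in> {0..1} \<Longrightarrow> (left_map ^^ n) t \<in> {0..1}"
  by (induction n) (use left_map_in_unit in auto)

lemma left_map_pos:
  assumes "t \<in> {0<..1}"
  shows "left_map t \<in> {0<..1}"
proof -
  have "0 < a * t" using assms a_pos by simp
  then have "0 < left_map t"
    using b_pos ac_le_1 by (auto simp: left_map_def)
  moreover have "left_map t \<in> {0..1}" using assms by (intro left_map_in_unit) auto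
  ultimately show ?thesis by auto
qed

lemma left_orbit_pos: "t \<in> {0<..1} \<Longrightarrow> (left_map ^^ n) t \<in> {0<..1}"
  by (induction n) (use left_map_pos in auto)

lemma inv_deriv_0 [simp]: "inv_deriv t 0 = 1"
  by (simp add: inv_deriv_def)

lemma inv_deriv_Suc: "inv_deriv t (Suc n) = inv_deriv t n / left_slope ((left_map ^^ n) t)"
  by (simp add: inv_deriv_def)

lemma inv_deriv_pos: "0 < inv_deriv t n"
  unfolding inv_deriv_def using left_slope_pos by (intro prod_pos) auto

text \<open>In the adapted weight each step expands by at least 1 / q > 1. The quotients of
  \<open>u\<close> telescope along the orbit and \<open>u\<close> is bounded away from 0 and
  infinity, so the decay is geometric even if one slope is below 1.\<close>

lemma summable_inv_deriv:
  assumes t: "t \<in> {0..1}"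
  shows "summable (inv_deriv t)"
proof -
  obtain s where s: "-1 < s" "0 < a - 1 - s * (1 - a * c)" "0 < b - 1 + s * b * c"
    using overlap_pos_weight[OF overlap] .
  define u where "u x = 1 + s * x" for x
  define d where "d = min (a - 1 - s * (1 - a * c)) (b - 1 + s * b * c)"
  define q where "q = 1 / (1 + d / max 1 (1 + s))"
  have d: "0 < d" using s by (simp add: d_def)
  then have dM: "0 < d / max 1 (1 + s)" by simp
  then have q: "0 < q" "q < 1" by (auto simp: q_def)
  have u: "0 < u x" "min 1 (1 + s) \<le> u x" "u x \<le> max 1 (1 + s)" if "x \<in> {0..1}" for x
    using weight_pos[OF s(1) that] by (auto simp: u_def)
  have step: "1 / left_slope x \<le> q * (u x / u (left_map x))" if x: "x \<in> {0..1}" for x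
  proof -
    note y = left_map_in_unit[OF x]
    have "u (left_map x) + d \<le> left_slope x * u x"
      by (auto simp: u_def left_map_def left_slope_def d_def min_def algebra_simps)
    moreover have "d / max 1 (1 + s) * u (left_map x) \<le> d"
      using mult_left_mono[OF u(3)[OF y], of d] d by (simp add: divide_le_eq)
    ultimately have "(1 + d / max 1 (1 + s)) * u (left_map x) \<le> left_slope x * u x"
      by (simp add: distrib_right)
    then have "u (left_map x) \<le> left_slope x * u x / (1 + d / max 1 (1 + s))"
      using dM by (subst pos_le_divide_eq) (auto simp: mult.commute)
    then have "1 * u (left_map x) \<le> (q * u x) * left_slope x"
      by (simp add: q_def mult.commute)
    then have "1 / left_slope x \<le> (q * u x) / u (left_map x)"
      by (subst frac_le_eq) (use left_slope_pos[of x] u(1)[OF y] in \<open>auto simp: divide_le_0_iff\<close>)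
    then show ?thesis by simp
  qed
  have bound: "inv_deriv t n \<le> q ^ n * (u t / u ((left_map ^^ n) t))" for n
  proof (induction n)
    case 0
    show ?case using u(1)[OF t] by simp
  next
    case (Suc n)
    let ?x = "(left_map ^^ n) t"
    have x: "?x \<in> {0..1}" using left_orbit_in_unit[OF t] .
    have "inv_deriv t (Suc n) = inv_deriv t n * (1 / left_slope ?x)"
      by (simp add: inv_deriv_Suc)
    also have "\<dots> \<le> (q ^ n * (u t / u ?x)) * (q * (u ?x / u (left_map ?x)))"
      using Suc step[OF x] inv_deriv_pos[of t n] left_slope_pos[of ?x] q u(1)[OF t] u(1)[OF x]
      by (intro mult_mono) auto
    also have "\<dots> = q ^ Suc n * (u t / u ((left_map ^^ Suc n) t))"
      using u(1)[OF x] by simp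
    finally show ?case .
  qed
  have geom: "summable (\<lambda>n. q ^ n * (u t / min 1 (1 + s)))"
    using q by (intro summable_mult2 summable_geometric) auto
  have "norm (inv_deriv t n) \<le> q ^ n * (u t / min 1 (1 + s))" for n
  proof -
    have "inv_deriv t n \<le> q ^ n * (u t / u ((left_map ^^ n) t))" by (rule bound)
    also have "\<dots> \<le> q ^ n * (u t / min 1 (1 + s))"
      using u[OF left_orbit_in_unit[OF t, of n]] u(1)[OF t] q s(1)
      by (intro mult_left_mono divide_left_mono) auto
    finally show ?thesis using inv_deriv_pos[of t n] by simp
  qed
  then show ?thesis
    by (intro summable_comparison_test'[OF geom, of 0])
qed

definition mass :: "real \<Rightarrow> real" where
  "mass t = (\<Sum>n. inv_deriv t n)"

text \<open>Collects the constants: P 1_[0,z] contains the term 1 / a exactly when z lies beyond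
  \<open>c\<close>.\<close>

definition right_mass :: "real \<Rightarrow> real" where
  "right_mass t = (\<Sum>n. inv_deriv t n * of_bool (c < (left_map ^^ n) t))"

definition step_series :: "real \<Rightarrow> real \<Rightarrow> real" where
  "step_series t x = (\<Sum>n. inv_deriv t n * of_bool (x \<le> (left_map ^^ n) t))"

lemma summable_inv_deriv_of_bool:
  assumes "t \<in> {0..1}"
  shows "summable (\<lambda>n. inv_deriv t n * of_bool (p n))"
  using summable_inv_deriv[OF assms] inv_deriv_pos[of t]
  by (intro summable_comparison_test'[OF summable_inv_deriv[OF assms], of 0])
     (auto simp: less_imp_le)

lemma mass_pos: "t \<in> {0..1} \<Longrightarrow> 0 < mass t"
  unfolding mass_def using summable_inv_deriv inv_deriv_pos by (intro suminf_pos) auto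

lemma step_series_antimono:
  assumes "t \<in> {0..1}" "x \<le> y"
  shows "step_series t y \<le> step_series t x"
  unfolding step_series_def using assms inv_deriv_pos[of t]
  by (intro suminf_le summable_inv_deriv_of_bool) (auto simp: less_imp_le)

lemma step_series_bounds:
  assumes "t \<in> {0..1}"
  shows "0 \<le> step_series t x" "step_series t x \<le> mass t"
proof -
  show "0 \<le> step_series t x"
    unfolding step_series_def using assms inv_deriv_pos[of t]
    by (intro suminf_nonneg summable_inv_deriv_of_bool) (auto simp: less_imp_le)
  show "step_series t x \<le> mass t"
    unfolding step_series_def mass_def using assms inv_deriv_pos[of t]
    by (intro suminf_le summable_inv_deriv_of_bool summable_inv_deriv) (auto simp: less_imp_le)
qed

lemma borel_measurable_step_series [measurable]: "step_series t \<in> borel_measurable borel"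
  unfolding step_series_def[abs_def] by measurable

lemma integrable_step_series:
  assumes "t \<in> {0..1}"
  shows "integrable unit_lborel (step_series t)"
proof (rule unit_lborel.integrable_const_bound)
  show "AE x in unit_lborel. norm (step_series t x) \<le> mass t"
    using step_series_bounds[OF assms] by (intro AE_I2) simp
qed (intro borel_measurable_unit_lborelI borel_measurable_step_series)

section \<open>The action of the transfer operator on step functions\<close>

context
  fixes \<psi> :: "real \<Rightarrow> real"
  assumes \<psi>: "\<psi> \<in> borel_measurable unit_lborel" "\<And>x. x \<in> {0..1} \<Longrightarrow> \<bar>\<psi> x\<bar> \<le> 1"
begin

lemma test_comp_f:
  "(\<lambda>x. \<psi> (f x)) \<in> borel_measurable unit_lborel" "x \<in> {0..1} \<Longrightarrow> \<bar>\<psi> (f x)\<bar> \<le> 1"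
  using \<psi>(2) f_in_unit by (auto intro: measurable_compose[OF measurable_f \<psi>(1)])

lemma integrable_atMost_test:
  "integrable unit_lborel (\<lambda>x. of_bool (x \<le> t) * \<psi> x)"
  by (rule integrable_mult_bounded[OF integrable_of_bool_atMost \<psi>])

text \<open>Integration term by term, dominated by the summable \<open>inv_deriv t\<close>. The
  \<open>sums\<close> form prepares the index shift below.\<close>

lemma integral_step_series:
  assumes t: "t \<in> {0..1}"
  shows "(\<lambda>n. inv_deriv t n * (\<integral>x. of_bool (x \<le> (left_map ^^ n) t) * \<psi> x \<partial>unit_lborel)) sums
    (\<integral>x. step_series t x * \<psi> x \<partial>unit_lborel)"
proof -
  let ?F = "\<lambda>n x. inv_deriv t n * (of_bool (x \<le> (left_map ^^ n) t) * \<psi> x)"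
  have int: "integrable unit_lborel (?F n)" for n
    by (intro integrable_mult_right integrable_atMost_test)
  have le: "norm (?F n x) \<le> inv_deriv t n" if "x \<in> {0..1}" for n x
    using \<psi>(2)[OF that] inv_deriv_pos[of t n] by (auto simp: abs_mult mult_left_le)
  have "(\<lambda>n. integral\<^sup>L unit_lborel (?F n)) sums (\<integral>x. (\<Sum>n. ?F n x) \<partial>unit_lborel)"
  proof (rule sums_integral[OF int])
    show "AE x in unit_lborel. summable (\<lambda>n. norm (?F n x))"
    proof (rule AE_I2)
      fix x assume "x \<in> space unit_lborel"
      then show "summable (\<lambda>n. norm (?F n x))"
        using le by (intro summable_comparison_test'[OF summable_inv_deriv[OF t], of 0]) simp
    qed
    have "(\<integral>x. norm (?F n x) \<partial>unit_lborel) \<le> (\<integral>x. inv_deriv t n \<partial>unit_lborel)" for n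
      using le int by (intro integral_mono integrable_norm) auto
    then have "(\<integral>x. norm (?F n x) \<partial>unit_lborel) \<le> inv_deriv t n" for n
      using unit_lborel.prob_space by simp
    moreover have "0 \<le> (\<integral>x. norm (?F n x) \<partial>unit_lborel)" for n by simp
    ultimately show "summable (\<lambda>n. \<integral>x. norm (?F n x) \<partial>unit_lborel)"
      by (intro summable_comparison_test'[OF summable_inv_deriv[OF t], of 0]) simp
  qed
  moreover have "(\<Sum>n. ?F n x) = step_series t x * \<psi> x" for x
    unfolding step_series_def
    using suminf_mult2[OF summable_inv_deriv_of_bool[OF t], of "\<lambda>n. x \<le> (left_map ^^ n) t" "\<psi> x"]
    by (simp add: mult.assoc)
  ultimately show ?thesis by simp
qed

text \<open>For t \<le> c only a piece of the left branch contributes, 1_[f(0),f(t)] / a; beyond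
  \<open>c\<close> the full left branch gives 1_[f(0),1] / a. As differences of initial intervals
  both contain the same correction -1_[0,f(0)] / a. The value 1 of \<open>left_map\<close> at
  \<open>c\<close> makes t = c fit the first case.\<close>

lemma frobenius_perron_atMost:
  assumes t: "t \<in> {0..1}"
  shows "AE y in unit_lborel. P (\<lambda>x. of_bool (x \<le> t)) y =
    of_bool (y \<le> left_map t) / left_slope t - of_bool (y \<le> 1 - a * c) / a + of_bool (c < t) / a"
proof -
  have ne: "AE y in unit_lborel. y \<noteq> 0 \<and> y \<noteq> 1 - a * c"
    using AE_unit_lborel_neq[of 0] AE_unit_lborel_neq[of "1 - a * c"] by eventually_elim simp
  have *: "P (\<lambda>x. of_bool (x \<le> t)) y =
      of_bool (y \<le> left_map t) / left_slope t - of_bool (y \<le> 1 - a * c) / a + of_bool (c < t) / a"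
    if y: "y \<in> {0..1}" "y \<noteq> 0" "y \<noteq> 1 - a * c" for y
  proof -
    have left: "(y - (1 - a * c)) / a \<le> t \<longleftrightarrow> y \<le> a * t + 1 - a * c"
      using a_pos by (auto simp: pos_divide_le_eq mult.commute)
    have right: "(y + b * c) / b \<le> t \<longleftrightarrow> y \<le> b * (t - c)"
      using b_pos by (auto simp: pos_divide_le_eq algebra_simps)
    have at: "t \<le> c \<Longrightarrow> a * t \<le> a * c" "c < t \<Longrightarrow> a * c < a * t" using a_pos by auto
    have bt: "t \<le> c \<Longrightarrow> b * (t - c) \<le> 0" "b * (t - c) \<le> b * (1 - c)"
      using b_pos t by (auto simp: mult_nonneg_nonpos)
    have at0: "0 \<le> a * t" using a_pos t by simp
    show ?thesis
    proof (cases "t \<le> c")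
      case True
      then have "P (\<lambda>x. of_bool (x \<le> t)) y = indicator {1 - a * c..1} y / a * of_bool (y \<le> a * t + 1 - a * c)"
        using y bt(1) unfolding frobenius_perron_def left right by auto
      then show ?thesis
        using True y at at0 by (auto simp: left_map_def left_slope_def indicator_def)
    next
      case False
      then have "P (\<lambda>x. of_bool (x \<le> t)) y = indicator {1 - a * c..1} y / a + of_bool (y \<le> b * (t - c)) / b"
        using y bt(2) at unfolding frobenius_perron_def left right by (auto simp: indicator_def)
      then show ?thesis
        using False y by (auto simp: left_map_def left_slope_def indicator_def)
    qed
  qed
  show ?thesis
    using ne AE_space by eventually_elim (use * in auto)
qed

lemma integral_atMost_comp_f:
  assumes t: "t \<in> {0..1}"
  shows "(\<integral>x. of_bool (x \<le> t) * \<psi> (f x) \<partial>unit_lborel) =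
    (\<integral>x. of_bool (x \<le> left_map t) * \<psi> x \<partial>unit_lborel) / left_slope t
    - (\<integral>x. of_bool (x \<le> 1 - a * c) * \<psi> x \<partial>unit_lborel) / a
    + of_bool (c < t) * (\<integral>x. \<psi> x \<partial>unit_lborel) / a"
proof -
  note int = integrable_of_bool_atMost[of t]
  note int\<psi> = integrable_bounded[OF \<psi>]
  let ?R = "\<lambda>y. of_bool (y \<le> left_map t) * \<psi> y / left_slope t - of_bool (y \<le> 1 - a * c) * \<psi> y / a
    + of_bool (c < t) / a * \<psi> y"
  have R: "integrable unit_lborel ?R"
    by (intro Bochner_Integration.integrable_add Bochner_Integration.integrable_diff
      integrable_divide_zero integrable_mult_right integrable_atMost_test int\<psi>)
  have "(\<integral>x. of_bool (x \<le> t) * \<psi> (f x) \<partial>unit_lborel) =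
      (\<integral>x. P (\<lambda>x. of_bool (x \<le> t)) x * \<psi> x \<partial>unit_lborel)"
    using frobenius_perron_dual(2)[OF int \<psi>] by simp
  also have "\<dots> = (\<integral>y. ?R y \<partial>unit_lborel)"
  proof (rule integral_cong_AE)
    show "AE y in unit_lborel. P (\<lambda>x. of_bool (x \<le> t)) y * \<psi> y = ?R y"
      using frobenius_perron_atMost[OF t]
      by eventually_elim (simp only: distrib_right left_diff_distrib times_divide_eq_left)
  qed (use frobenius_perron_dual(1)[OF int \<psi>] R in auto)
  also have "\<dots> = (\<integral>x. of_bool (x \<le> left_map t) * \<psi> x \<partial>unit_lborel) / left_slope t
    - (\<integral>x. of_bool (x \<le> 1 - a * c) * \<psi> x \<partial>unit_lborel) / a
    + of_bool (c < t) / a * (\<integral>x. \<psi> x \<partial>unit_lborel)"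
    using int\<psi> integrable_atMost_test
    by (simp only: Bochner_Integration.integral_add Bochner_Integration.integral_diff
      Bochner_Integration.integrable_diff integrable_divide_zero integrable_mult_right
      integral_divide_zero integral_mult_right_zero)
  finally show ?thesis by simp
qed

end

text \<open>\<open>P\<close> sends the n-th term of the series to the next one plus corrections. In
  the difference only the initial term 1_[0,t] survives, while the corrections add up to
  \<open>mass t\<close> and \<open>right_mass t\<close>.\<close>

lemma integral_step_series_coboundary:
  fixes \<psi> :: "real \<Rightarrow> real"
  assumes \<psi>: "\<psi> \<in> borel_measurable unit_lborel" "\<And>x. x \<in> {0..1} \<Longrightarrow> \<bar>\<psi> x\<bar> \<le> 1"
    and t: "t \<in> {0..1}"
  shows "(\<integral>x. step_series t x * \<psi> x \<partial>unit_lborel) - (\<integral>x. step_series t x * \<psi> (f x) \<partial>unit_lborel) =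
    (\<integral>x. of_bool (x \<le> t) * \<psi> x \<partial>unit_lborel)
    + mass t / a * (\<integral>x. of_bool (x \<le> 1 - a * c) * \<psi> x \<partial>unit_lborel)
    - right_mass t / a * (\<integral>x. \<psi> x \<partial>unit_lborel)"
proof -
  define I where "I z = (\<integral>x. of_bool (x \<le> z) * \<psi> x \<partial>unit_lborel)" for z
  define J where "J = (\<integral>x. \<psi> x \<partial>unit_lborel)"
  let ?z = "\<lambda>n. (left_map ^^ n) t"
  have S: "(\<lambda>n. inv_deriv t n * I (?z n)) sums (\<integral>x. step_series t x * \<psi> x \<partial>unit_lborel)"
    using integral_step_series[OF \<psi> t] by (simp add: I_def)
  then have "(\<lambda>n. inv_deriv t (Suc n) * I (?z (Suc n))) sums
      ((\<integral>x. step_series t x * \<psi> x \<partial>unit_lborel) - I t)"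
    by (subst sums_Suc_iff) simp
  moreover have "(\<lambda>n. inv_deriv t n * (I (1 - a * c) / a)) sums (mass t * (I (1 - a * c) / a))"
    unfolding mass_def using summable_inv_deriv[OF t] by (intro sums_mult2 summable_sums)
  moreover have "(\<lambda>n. inv_deriv t n * of_bool (c < ?z n) * (J / a)) sums (right_mass t * (J / a))"
    unfolding right_mass_def using summable_inv_deriv_of_bool[OF t] by (intro sums_mult2 summable_sums)
  ultimately have "(\<lambda>n. inv_deriv t (Suc n) * I (?z (Suc n)) - inv_deriv t n * (I (1 - a * c) / a)
      + inv_deriv t n * of_bool (c < ?z n) * (J / a)) sums
      ((\<integral>x. step_series t x * \<psi> x \<partial>unit_lborel) - I t - mass t * (I (1 - a * c) / a) + right_mass t * (J / a))"
    by (intro sums_add sums_diff)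
  moreover have "inv_deriv t (Suc n) * I (?z (Suc n)) - inv_deriv t n * (I (1 - a * c) / a)
      + inv_deriv t n * of_bool (c < ?z n) * (J / a) =
      inv_deriv t n * (\<integral>x. of_bool (x \<le> ?z n) * \<psi> (f x) \<partial>unit_lborel)" for n
  proof -
    have "(\<integral>x. of_bool (x \<le> ?z n) * \<psi> (f x) \<partial>unit_lborel) =
        I (?z (Suc n)) / left_slope (?z n) - I (1 - a * c) / a + of_bool (c < ?z n) * J / a"
      using integral_atMost_comp_f[OF \<psi> left_orbit_in_unit[OF t, of n]] by (simp add: I_def J_def)
    then show ?thesis by (simp only: inv_deriv_Suc) (simp add: right_diff_distrib distrib_left)
  qed
  ultimately have "(\<lambda>n. inv_deriv t n * (\<integral>x. of_bool (x \<le> ?z n) * \<psi> (f x) \<partial>unit_lborel)) sums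
      ((\<integral>x. step_series t x * \<psi> x \<partial>unit_lborel) - I t - mass t * (I (1 - a * c) / a) + right_mass t * (J / a))"
    by simp
  from sums_unique2[OF this integral_step_series[OF test_comp_f[OF \<psi>] t]]
  show ?thesis by (simp add: I_def J_def)
qed

text \<open>A potential solving G - P G = 1_[0,t] - t almost everywhere. The factor of S_0 cancels
  the coefficient \<open>mass t / a\<close> of 1_[0,f(0)]; S_0 adds no step of its own because
  1_[0,0] vanishes almost everywhere.\<close>

definition green :: "real \<Rightarrow> real \<Rightarrow> real" where
  "green t x = step_series t x - mass t / mass 0 * step_series 0 x"

lemma integrable_green: "t \<in> {0..1} \<Longrightarrow> integrable unit_lborel (green t)"
  unfolding green_def[abs_def] using integrable_step_series by simp

lemma integral_green_coboundary:
  fixes \<psi> :: "real \<Rightarrow> real"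
  assumes \<psi>: "\<psi> \<in> borel_measurable unit_lborel" "\<And>x. x \<in> {0..1} \<Longrightarrow> \<bar>\<psi> x\<bar> \<le> 1"
    and t: "t \<in> {0..1}"
  shows "(\<integral>x. of_bool (x \<le> t) * \<psi> x \<partial>unit_lborel) = t * (\<integral>x. \<psi> x \<partial>unit_lborel)
    + (\<integral>x. green t x * \<psi> x \<partial>unit_lborel) - (\<integral>x. green t x * \<psi> (f x) \<partial>unit_lborel)"
proof -
  define \<kappa> where "\<kappa> = right_mass t / a - mass t / mass 0 * (right_mass 0 / a)"
  have *: "(\<integral>x. green t x * \<psi> x \<partial>unit_lborel) - (\<integral>x. green t x * \<psi> (f x) \<partial>unit_lborel) =
      (\<integral>x. of_bool (x \<le> t) * \<psi> x \<partial>unit_lborel) - \<kappa> * (\<integral>x. \<psi> x \<partial>unit_lborel)"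
    if \<psi>: "\<psi> \<in> borel_measurable unit_lborel" "\<And>x. x \<in> {0..1} \<Longrightarrow> \<bar>\<psi> x\<bar> \<le> 1" for \<psi> :: "real \<Rightarrow> real"
  proof -
    have split: "(\<integral>x. green t x * \<phi> x \<partial>unit_lborel) =
        (\<integral>x. step_series t x * \<phi> x \<partial>unit_lborel) - mass t / mass 0 * (\<integral>x. step_series 0 x * \<phi> x \<partial>unit_lborel)"
      if \<phi>: "\<phi> \<in> borel_measurable unit_lborel" "\<And>x. x \<in> {0..1} \<Longrightarrow> \<bar>\<phi> x\<bar> \<le> 1" for \<phi>
    proof -
      have "integrable unit_lborel (\<lambda>x. step_series t x * \<phi> x)" "integrable unit_lborel (\<lambda>x. step_series 0 x * \<phi> x)"
        using t by (auto intro!: integrable_mult_bounded[OF _ \<phi>] integrable_step_series)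
      then show ?thesis
        by (simp add: green_def left_diff_distrib mult.assoc)
    qed
    have I0: "(\<integral>x. of_bool (x \<le> 0) * \<psi> x \<partial>unit_lborel) = 0"
    proof (rule integral_eq_zero_AE)
      show "AE x in unit_lborel. of_bool (x \<le> 0) * \<psi> x = 0"
        using AE_unit_lborel_neq[of 0] AE_space by eventually_elim auto
    qed
    have z: "0 \<in> {0..1::real}" by simp
    have "mass 0 \<noteq> 0" using mass_pos[OF z] by simp
    define D where "D t = (\<integral>x. step_series t x * \<psi> x \<partial>unit_lborel) - (\<integral>x. step_series t x * \<psi> (f x) \<partial>unit_lborel)" for t
    define I where "I z = (\<integral>x. of_bool (x \<le> z) * \<psi> x \<partial>unit_lborel)" for z
    define J where "J = (\<integral>x. \<psi> x \<partial>unit_lborel)"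
    have D: "D t = I t + mass t / a * I (1 - a * c) - right_mass t / a * J" if "t \<in> {0..1}" for t
      unfolding D_def I_def J_def by (rule integral_step_series_coboundary[OF \<psi> that])
    have "(\<integral>x. green t x * \<psi> x \<partial>unit_lborel) - (\<integral>x. green t x * \<psi> (f x) \<partial>unit_lborel) =
        D t - mass t / mass 0 * D 0"
      using split[OF \<psi>] split[OF test_comp_f[OF \<psi>]] by (simp add: D_def right_diff_distrib)
    also have "\<dots> = I t + mass t / a * I (1 - a * c) - right_mass t / a * J
        - (mass t / mass 0 * mass 0 / a * I (1 - a * c) - mass t / mass 0 * (right_mass 0 / a) * J)"
      using I0 unfolding D[OF t] D[OF z] by (simp add: I_def right_diff_distrib)
    also have "\<dots> = I t - \<kappa> * J"
      using \<open>mass 0 \<noteq> 0\<close> by (simp add: \<kappa>_def left_diff_distrib)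
    finally show ?thesis by (simp add: I_def J_def)
  qed
  \<comment> \<open>Coboundaries have integral 0, so the test function 1 identifies the remaining
    constant.\<close>
  have "\<kappa> = t"
  proof -
    have "(\<integral>x. of_bool (x \<le> t) * 1 \<partial>unit_lborel) = \<kappa>"
      using *[of "\<lambda>_. 1"] unit_lborel.prob_space by simp
    then show ?thesis using integral_atMost[OF t] by simp
  qed
  then show ?thesis using *[OF \<psi>] by simp
qed

lemma weakly_invariant_green: "weakly_invariant f (green 1)"
proof (rule weakly_invariantI)
  fix \<psi> :: "real \<Rightarrow> real"
  assume \<psi>: "\<psi> \<in> borel_measurable unit_lborel" "\<And>x. x \<in> {0..1} \<Longrightarrow> \<bar>\<psi> x\<bar> \<le> 1"
  have "(\<integral>x. of_bool (x \<le> 1) * \<psi> x \<partial>unit_lborel) = (\<integral>x. \<psi> x \<partial>unit_lborel)"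
    by (intro Bochner_Integration.integral_cong) auto
  then show "(\<integral>x. green 1 x * \<psi> (f x) \<partial>unit_lborel) = (\<integral>x. green 1 x * \<psi> x \<partial>unit_lborel)"
    using integral_green_coboundary[OF \<psi>, of 1] by simp
qed

text \<open>Just right of 0, S_1 comes close to \<open>mass 1\<close>, since the orbit of 1 stays
  positive. S_0 is at most \<open>mass 0 - 1\<close>, since the orbit of 0 starts at 0 and loses its
  first term. The difference leaves nearly \<open>mass 1 / mass 0\<close>, the constant
  \<open>e\<close> of the proof.\<close>

lemma green_pos_near_0:
  obtains \<delta> where "0 < \<delta>" "\<delta> \<le> 1" "\<forall>x. 0 < x \<longrightarrow> x < \<delta> \<longrightarrow> 0 < green 1 x"
proof -
  have unit: "0 \<in> {0..1::real}" "1 \<in> {0..1::real}" by auto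
  define e where "e = mass 1 / mass 0"
  have e: "0 < e" using mass_pos unit by (simp add: e_def)
  have "(\<lambda>N. \<Sum>n<N. inv_deriv 1 n) \<longlonglongrightarrow> mass 1"
    unfolding mass_def using summable_inv_deriv[OF unit(2)] by (rule summable_LIMSEQ)
  then have "eventually (\<lambda>N. mass 1 - e < (\<Sum>n<N. inv_deriv 1 n)) sequentially"
    using e by (intro order_tendstoD) auto
  then obtain N where N: "mass 1 - e < (\<Sum>n<N. inv_deriv 1 n)"
    using eventually_happens by fastforce
  \<comment> \<open>Below the first \<open>N\<close> points of the orbit of 1 all their steps are
    present. Inserting 1 keeps the set nonempty for \<open>N = 0\<close> and bounds \<delta> by
    1.\<close>
  define \<delta> where "\<delta> = Min (insert 1 ((\<lambda>n. (left_map ^^ n) 1) ` {..<N}))"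
  have pos: "0 < \<delta>" unfolding \<delta>_def using left_orbit_pos[of 1] by (subst Min_gr_iff) auto
  have le1: "\<delta> \<le> 1" unfolding \<delta>_def by (intro Min_le) auto
  have "0 < green 1 x" if x: "0 < x" "x < \<delta>" for x
  proof -
    have "x \<le> (left_map ^^ n) 1" if "n < N" for n
    proof -
      have "\<delta> \<le> (left_map ^^ n) 1" unfolding \<delta>_def using that by (intro Min_le) auto
      then show ?thesis using x by simp
    qed
    then have "(\<Sum>n<N. inv_deriv 1 n) = (\<Sum>n<N. inv_deriv 1 n * of_bool (x \<le> (left_map ^^ n) 1))"
      by (intro sum.cong) auto
    also have "\<dots> \<le> step_series 1 x"
      unfolding step_series_def using inv_deriv_pos[of 1] unit
      by (intro sum_le_suminf summable_inv_deriv_of_bool) (auto simp: less_imp_le)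
    finally have S1: "mass 1 - e < step_series 1 x" using N by simp
    have "step_series 0 x = (\<Sum>n. inv_deriv 0 (Suc n) * of_bool (x \<le> (left_map ^^ Suc n) 0))"
      using suminf_split_head[OF summable_inv_deriv_of_bool[OF unit(1), of "\<lambda>n. x \<le> (left_map ^^ n) 0"]] x
      by (simp add: step_series_def)
    also have "\<dots> \<le> (\<Sum>n. inv_deriv 0 (Suc n))"
    proof (rule suminf_le)
      show "summable (\<lambda>n. inv_deriv 0 (Suc n) * of_bool (x \<le> (left_map ^^ Suc n) 0))"
        using summable_inv_deriv_of_bool[OF unit(1), of "\<lambda>n. x \<le> (left_map ^^ n) 0"]
        by (subst summable_Suc_iff)
      show "summable (\<lambda>n. inv_deriv 0 (Suc n))"
        using summable_inv_deriv[OF unit(1)] by (subst summable_Suc_iff)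
    qed (use inv_deriv_pos[of 0] in \<open>auto simp: less_imp_le\<close>)
    also have "\<dots> = mass 0 - 1"
      unfolding mass_def using suminf_split_head[OF summable_inv_deriv[OF unit(1)]] by simp
    finally have "e * step_series 0 x \<le> e * (mass 0 - 1)"
      using e by (intro mult_left_mono) auto
    also have "\<dots> = mass 1 - e" using mass_pos[OF unit(1)] by (simp add: e_def right_diff_distrib)
    finally show ?thesis using S1 by (simp add: green_def e_def)
  qed
  then show ?thesis using pos le1 that by blast
qed

text \<open>Excludes the trivial invariant function; without this, normalization by the integral
  could fail.\<close>

lemma green_not_AE_zero: "\<not> (AE x in unit_lborel. green 1 x = 0)"
proof
  assume "AE x in unit_lborel. green 1 x = 0"
  then have ae: "AE x in lborel. x \<in> {0..1} \<longrightarrow> green 1 x = 0"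
    unfolding unit_lborel_def by (subst (asm) AE_restrict_space_iff) auto
  obtain \<delta> where \<delta>: "0 < \<delta>" "\<delta> \<le> 1" "\<forall>x. 0 < x \<longrightarrow> x < \<delta> \<longrightarrow> 0 < green 1 x"
    using green_pos_near_0 .
  have "AE x in lborel. x \<notin> {0<..<\<delta>}"
    using ae by eventually_elim (use \<delta> in force)
  then have "{0<..<\<delta>} \<in> null_sets lborel"
    by (subst AE_iff_null_sets) auto
  then show False using \<delta>(1) by (simp add: null_sets_def)
qed

text \<open>Both series are nonincreasing with values in [0, \<open>mass 1\<close>] and
  [0, \<open>mass 0\<close>], so their variations telescope.\<close>

lemma bounded_variation_green: "bounded_variation_on 0 1 (\<lambda>x. green 1 x / k)"
  unfolding bounded_variation_on_def
proof (intro exI allI impI)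
  fix n :: nat and x :: "nat \<Rightarrow> real"
  assume "(\<forall>i\<le>n. x i \<in> {0..1}) \<and> (\<forall>i<n. x i \<le> x (Suc i))"
  then have mono: "i < n \<Longrightarrow> x i \<le> x (Suc i)" for i by blast
  have unit: "0 \<in> {0..1::real}" "1 \<in> {0..1::real}" by auto
  let ?\<rho> = "mass 1 / mass 0"
  have \<rho>: "0 \<le> ?\<rho>" using mass_pos unit by (simp add: less_imp_le)
  have var: "(\<Sum>i<n. step_series t (x i) - step_series t (x (Suc i))) \<le> mass t" if "t \<in> {0..1}" for t
    using sum_lessThan_telescope'[of "\<lambda>i. step_series t (x i)" n] step_series_bounds[OF that, of "x 0"] step_series_bounds[OF that, of "x n"] by linarith
  have "(\<Sum>i<n. \<bar>green 1 (x (Suc i)) / k - green 1 (x i) / k\<bar>) \<le>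
      (\<Sum>i<n. ((step_series 1 (x i) - step_series 1 (x (Suc i)))
        + ?\<rho> * (step_series 0 (x i) - step_series 0 (x (Suc i)))) / \<bar>k\<bar>)"
  proof (rule sum_mono)
    fix i assume "i \<in> {..<n}"
    then have i: "x i \<le> x (Suc i)" using mono by simp
    have 1: "step_series 1 (x (Suc i)) \<le> step_series 1 (x i)"
      using step_series_antimono[OF unit(2) i] .
    have 0: "?\<rho> * step_series 0 (x (Suc i)) \<le> ?\<rho> * step_series 0 (x i)"
      using step_series_antimono[OF unit(1) i] \<rho> by (rule mult_left_mono)
    have "\<bar>green 1 (x (Suc i)) / k - green 1 (x i) / k\<bar> = \<bar>green 1 (x (Suc i)) - green 1 (x i)\<bar> / \<bar>k\<bar>"
      by (simp add: abs_divide flip: diff_divide_distrib)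
    also have "\<bar>green 1 (x (Suc i)) - green 1 (x i)\<bar> \<le> (step_series 1 (x i) - step_series 1 (x (Suc i)))
        + ?\<rho> * (step_series 0 (x i) - step_series 0 (x (Suc i)))"
      using 0 1 unfolding green_def right_diff_distrib by linarith
    finally show "\<bar>green 1 (x (Suc i)) / k - green 1 (x i) / k\<bar> \<le>
        ((step_series 1 (x i) - step_series 1 (x (Suc i)))
        + ?\<rho> * (step_series 0 (x i) - step_series 0 (x (Suc i)))) / \<bar>k\<bar>"
      by (simp add: divide_right_mono)
  qed
  also have "\<dots> = ((\<Sum>i<n. step_series 1 (x i) - step_series 1 (x (Suc i)))
      + ?\<rho> * (\<Sum>i<n. step_series 0 (x i) - step_series 0 (x (Suc i)))) / \<bar>k\<bar>"
    by (simp only: sum_divide_distrib[symmetric] sum.distrib sum_distrib_left[symmetric])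
  also have "\<dots> \<le> (mass 1 + ?\<rho> * mass 0) / \<bar>k\<bar>"
    using var[OF unit(1)] var[OF unit(2)] \<rho> by (intro divide_right_mono add_mono mult_left_mono) auto
  finally show "(\<Sum>i<n. \<bar>green 1 (x (Suc i)) / k - green 1 (x i) / k\<bar>) \<le> (mass 1 + ?\<rho> * mass 0) / \<bar>k\<bar>" .
qed

end

section \<open>Cesaro averages against a test function\<close>

context lorenz
begin

text \<open>On the dual side: the Cesaro mean of \<open>g\<close> minus that of Lebesgue measure
  scaled to the same mass, tested against \<psi>. Being linear in \<open>g\<close>, its convergence
  to 0 can be checked on generators.\<close>

definition cesaro_defect :: "(real \<Rightarrow> real) \<Rightarrow> nat \<Rightarrow> (real \<Rightarrow> real) \<Rightarrow> real" where
  "cesaro_defect \<psi> n g =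
    (\<Sum>j<n. \<integral>x. (g x - (\<integral>y. g y \<partial>unit_lborel)) * \<psi> ((f ^^ j) x) \<partial>unit_lborel) / real n"

context
  fixes \<psi> :: "real \<Rightarrow> real"
  assumes \<psi>: "\<psi> \<in> borel_measurable unit_lborel" "\<And>x. x \<in> {0..1} \<Longrightarrow> \<bar>\<psi> x\<bar> \<le> 1"
begin

lemma test_comp_funpow:
  "(\<lambda>x. \<psi> ((f ^^ j) x)) \<in> borel_measurable unit_lborel"
  "x \<in> {0..1} \<Longrightarrow> \<bar>\<psi> ((f ^^ j) x)\<bar> \<le> 1"
  using \<psi>(2) funpow_f_in_unit by (auto intro: measurable_compose[OF measurable_funpow_f \<psi>(1)])

lemma integrable_centered_test:
  assumes "integrable unit_lborel g"
  shows "integrable unit_lborel (\<lambda>x. (g x - (\<integral>y. g y \<partial>unit_lborel)) * \<psi> ((f ^^ j) x))"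
  by (rule integrable_mult_bounded[OF _ test_comp_funpow]) (use assms in auto)

lemma cesaro_defect_add:
  assumes "integrable unit_lborel g" "integrable unit_lborel h"
  shows "cesaro_defect \<psi> n (\<lambda>x. g x + h x) = cesaro_defect \<psi> n g + cesaro_defect \<psi> n h"
proof -
  have "(\<integral>x. (g x + h x - (\<integral>y. g y + h y \<partial>unit_lborel)) * \<psi> ((f ^^ j) x) \<partial>unit_lborel) =
      (\<integral>x. (g x - (\<integral>y. g y \<partial>unit_lborel)) * \<psi> ((f ^^ j) x) \<partial>unit_lborel) +
      (\<integral>x. (h x - (\<integral>y. h y \<partial>unit_lborel)) * \<psi> ((f ^^ j) x) \<partial>unit_lborel)" for j
    unfolding Bochner_Integration.integral_add[OF assms]
    by (subst Bochner_Integration.integral_add[symmetric, OF integrable_centered_test[OF assms(1)] integrable_centered_test[OF assms(2)]])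
       (simp add: algebra_simps)
  then show ?thesis
    by (simp add: cesaro_defect_def sum.distrib add_divide_distrib)
qed

lemma cesaro_defect_cmult: "cesaro_defect \<psi> n (\<lambda>x. k * g x) = k * cesaro_defect \<psi> n g"
proof -
  have "(\<integral>x. (k * g x - (\<integral>y. k * g y \<partial>unit_lborel)) * \<psi> ((f ^^ j) x) \<partial>unit_lborel) =
      k * (\<integral>x. (g x - (\<integral>y. g y \<partial>unit_lborel)) * \<psi> ((f ^^ j) x) \<partial>unit_lborel)" for j
    by (subst integral_mult_right_zero[symmetric]) (simp add: algebra_simps)
  then show ?thesis
    by (simp add: cesaro_defect_def sum_distrib_left)
qed

lemma cesaro_defect_diff:
  assumes "integrable unit_lborel g" "integrable unit_lborel h"
  shows "cesaro_defect \<psi> n (\<lambda>x. g x - h x) = cesaro_defect \<psi> n g - cesaro_defect \<psi> n h"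
  using cesaro_defect_add[OF assms(1), of "\<lambda>x. (-1) * h x" n] assms(2) cesaro_defect_cmult[of n "-1" h]
  by simp

lemma cesaro_defect_cong:
  assumes "\<And>x. x \<in> {0..1} \<Longrightarrow> g x = h x"
  shows "cesaro_defect \<psi> n g = cesaro_defect \<psi> n h"
proof -
  have "(\<integral>y. g y \<partial>unit_lborel) = (\<integral>y. h y \<partial>unit_lborel)"
    using assms by (intro Bochner_Integration.integral_cong) auto
  then have "(\<integral>x. (g x - (\<integral>y. g y \<partial>unit_lborel)) * \<psi> ((f ^^ j) x) \<partial>unit_lborel) =
      (\<integral>x. (h x - (\<integral>y. h y \<partial>unit_lborel)) * \<psi> ((f ^^ j) x) \<partial>unit_lborel)" for j
    using assms by (intro Bochner_Integration.integral_cong) auto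
  then show ?thesis by (simp add: cesaro_defect_def)
qed

text \<open>Uniformity in \<open>n\<close> is the point: it lets convergence pass to limits in L1.
  The factor 2 pays for subtracting the mean.\<close>

lemma abs_cesaro_defect_le:
  assumes g: "integrable unit_lborel g"
  shows "\<bar>cesaro_defect \<psi> n g\<bar> \<le> 2 * (\<integral>x. \<bar>g x\<bar> \<partial>unit_lborel)"
proof (cases "n = 0")
  case True
  then show ?thesis by (simp add: cesaro_defect_def)
next
  case False
  let ?m = "\<integral>y. g y \<partial>unit_lborel"
  let ?N = "\<integral>x. \<bar>g x\<bar> \<partial>unit_lborel"
  have "\<bar>\<integral>x. (g x - ?m) * \<psi> ((f ^^ j) x) \<partial>unit_lborel\<bar> \<le> 2 * ?N" for j
  proof -
    have "\<bar>\<integral>x. (g x - ?m) * \<psi> ((f ^^ j) x) \<partial>unit_lborel\<bar> \<le> (\<integral>x. \<bar>g x - ?m\<bar> \<partial>unit_lborel)"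
      by (rule abs_integral_mult_bounded[OF _ test_comp_funpow]) (use g in auto)
    also have "\<dots> \<le> (\<integral>x. \<bar>g x\<bar> + \<bar>?m\<bar> \<partial>unit_lborel)"
      using g by (intro integral_mono) auto
    also have "\<dots> = ?N + \<bar>?m\<bar>"
      using g unit_lborel.prob_space by (subst Bochner_Integration.integral_add) auto
    also have "\<bar>?m\<bar> \<le> ?N" by (rule integral_abs_bound)
    finally show ?thesis by simp
  qed
  then have "\<bar>\<Sum>j<n. \<integral>x. (g x - ?m) * \<psi> ((f ^^ j) x) \<partial>unit_lborel\<bar> \<le> (\<Sum>j<n. 2 * ?N)"
    by (intro order_trans[OF sum_abs] sum_mono)
  then show ?thesis
    using False by (simp add: cesaro_defect_def abs_divide divide_le_eq mult.commute)
qed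

lemma cesaro_defect_tendsto_zero_limit:
  assumes g: "integrable unit_lborel g"
    and h: "\<And>i. integrable unit_lborel (h i)" "\<And>i. (\<lambda>n. cesaro_defect \<psi> n (h i)) \<longlonglongrightarrow> 0"
    and lim: "(\<lambda>i. \<integral>x. \<bar>g x - h i x\<bar> \<partial>unit_lborel) \<longlonglongrightarrow> 0"
  shows "(\<lambda>n. cesaro_defect \<psi> n g) \<longlonglongrightarrow> 0"
proof (rule LIMSEQ_I)
  fix e :: real assume e: "0 < e"
  \<comment> \<open>A quarter, because \<open>abs_cesaro_defect_le\<close> doubles it and the other
    half of \<open>e\<close> goes to \<open>h i\<close>.\<close>
  have "eventually (\<lambda>i. (\<integral>x. \<bar>g x - h i x\<bar> \<partial>unit_lborel) < e / 4) sequentially"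
    using lim e by (intro order_tendstoD(2)) auto
  then obtain i where i: "(\<integral>x. \<bar>g x - h i x\<bar> \<partial>unit_lborel) < e / 4"
    using eventually_happens by fastforce
  obtain N where N: "\<And>n. N \<le> n \<Longrightarrow> \<bar>cesaro_defect \<psi> n (h i)\<bar> < e / 2"
    using LIMSEQ_D[OF h(2)[of i], of "e / 2"] e by auto
  show "\<exists>N. \<forall>n\<ge>N. norm (cesaro_defect \<psi> n g - 0) < e"
  proof (intro exI allI impI)
    fix n assume "N \<le> n"
    have "\<bar>cesaro_defect \<psi> n g - cesaro_defect \<psi> n (h i)\<bar> \<le> 2 * (\<integral>x. \<bar>g x - h i x\<bar> \<partial>unit_lborel)"
      unfolding cesaro_defect_diff[OF g h(1), symmetric] using g h(1) by (intro abs_cesaro_defect_le) auto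
    then show "norm (cesaro_defect \<psi> n g - 0) < e"
      using i N[OF \<open>N \<le> n\<close>] by simp
  qed
qed

text \<open>For invariant \<open>h\<close> the integrals of \<open>h\<close> against \<psi> composed
  with f^j do not depend on j; only the Lebesgue averages remain.\<close>

lemma cesaro_defect_weakly_invariant:
  assumes h: "integrable unit_lborel h" "weakly_invariant f h"
  shows "n > 0 \<Longrightarrow> cesaro_defect \<psi> n h = (\<integral>x. h x * \<psi> x \<partial>unit_lborel)
    - (\<integral>x. h x \<partial>unit_lborel) * ((\<Sum>j<n. \<integral>x. \<psi> ((f ^^ j) x) \<partial>unit_lborel) / real n)"
proof -
  have inv: "(\<integral>x. h x * \<psi> ((f ^^ j) x) \<partial>unit_lborel) = (\<integral>x. h x * \<psi> x \<partial>unit_lborel)" for j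
  proof (induction j)
    case (Suc j)
    have "(\<integral>x. h x * \<psi> ((f ^^ j) (f x)) \<partial>unit_lborel) = (\<integral>x. h x * \<psi> ((f ^^ j) x) \<partial>unit_lborel)"
      by (rule weakly_invariantD[OF h(2) test_comp_funpow])
    then show ?case using Suc by (simp add: funpow_swap1)
  qed simp
  have "(\<integral>x. (h x - (\<integral>y. h y \<partial>unit_lborel)) * \<psi> ((f ^^ j) x) \<partial>unit_lborel) =
      (\<integral>x. h x * \<psi> x \<partial>unit_lborel) - (\<integral>y. h y \<partial>unit_lborel) * (\<integral>x. \<psi> ((f ^^ j) x) \<partial>unit_lborel)" for j
  proof -
    have "integrable unit_lborel (\<lambda>x. h x * \<psi> ((f ^^ j) x))"
      by (rule integrable_mult_bounded[OF h(1) test_comp_funpow])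
    moreover have "integrable unit_lborel (\<lambda>x. \<psi> ((f ^^ j) x))"
      by (rule integrable_bounded[OF test_comp_funpow])
    ultimately show ?thesis by (simp add: left_diff_distrib inv)
  qed
  then show "n > 0 \<Longrightarrow> cesaro_defect \<psi> n h = (\<integral>x. h x * \<psi> x \<partial>unit_lborel)
    - (\<integral>x. h x \<partial>unit_lborel) * ((\<Sum>j<n. \<integral>x. \<psi> ((f ^^ j) x) \<partial>unit_lborel) / real n)"
    by (simp add: cesaro_defect_def sum_subtractf diff_divide_distrib sum_distrib_left)
qed

end

end

section \<open>Convergence of the averages, uniqueness and existence\<close>

context overlapping_lorenz
begin

context
  fixes \<psi> :: "real \<Rightarrow> real"
  assumes \<psi>: "\<psi> \<in> borel_measurable unit_lborel" "\<And>x. x \<in> {0..1} \<Longrightarrow> \<bar>\<psi> x\<bar> \<le> 1"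
begin

text \<open>The coboundary equation, tested with \<psi> composed with f^j, makes the j-th term
  \<open>G j - G (Suc j)\<close>. The telescoped sum is bounded and is divided by n.\<close>

lemma cesaro_defect_atMost:
  assumes t: "t \<in> {0..1}"
  shows "(\<lambda>n. cesaro_defect \<psi> n (\<lambda>x. of_bool (x \<le> t))) \<longlonglongrightarrow> 0"
proof -
  define G where "G j = (\<integral>x. green t x * \<psi> ((f ^^ j) x) \<partial>unit_lborel)" for j
  define K where "K = (\<integral>x. \<bar>green t x\<bar> \<partial>unit_lborel)"
  have G_le: "\<bar>G j\<bar> \<le> K" for j
    unfolding G_def K_def
    by (rule abs_integral_mult_bounded[OF integrable_green[OF t] test_comp_funpow[OF \<psi>]])
  have "(\<integral>x. (of_bool (x \<le> t) - (\<integral>y. of_bool (y \<le> t) \<partial>unit_lborel)) * \<psi> ((f ^^ j) x) \<partial>unit_lborel)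
      = G j - G (Suc j)" for j
  proof -
    have i1: "integrable unit_lborel (\<lambda>x. \<psi> ((f ^^ j) x))"
      by (rule integrable_bounded[OF test_comp_funpow[OF \<psi>]])
    have i2: "integrable unit_lborel (\<lambda>x. of_bool (x \<le> t) * \<psi> ((f ^^ j) x))"
      by (rule integrable_mult_bounded[OF integrable_of_bool_atMost test_comp_funpow[OF \<psi>]])
    have "(\<integral>x. of_bool (x \<le> t) * \<psi> ((f ^^ j) x) \<partial>unit_lborel) = t * (\<integral>x. \<psi> ((f ^^ j) x) \<partial>unit_lborel)
        + (\<integral>x. green t x * \<psi> ((f ^^ j) x) \<partial>unit_lborel) - (\<integral>x. green t x * \<psi> ((f ^^ j) (f x)) \<partial>unit_lborel)"
      by (rule integral_green_coboundary[OF test_comp_funpow[OF \<psi>] t])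
    then show ?thesis
      unfolding integral_atMost[OF t] using i1 i2
      by (simp add: left_diff_distrib G_def funpow_swap1)
  qed
  then have eq: "cesaro_defect \<psi> n (\<lambda>x. of_bool (x \<le> t)) = (G 0 - G n) / real n" for n
    by (simp add: cesaro_defect_def sum_lessThan_telescope')
  show ?thesis
    unfolding eq
  proof (rule Lim_null_comparison)
    show "\<forall>\<^sub>F n in sequentially. norm ((G 0 - G n) / real n) \<le> 2 * K / real n"
    proof (intro always_eventually allI)
      fix n
      have "\<bar>G 0 - G n\<bar> \<le> 2 * K" using G_le[of 0] G_le[of n] by linarith
      then show "norm ((G 0 - G n) / real n) \<le> 2 * K / real n"
        by (simp add: abs_divide divide_right_mono)
    qed
    show "(\<lambda>n. 2 * K / real n) \<longlonglongrightarrow> 0"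
      by (rule lim_const_over_n)
  qed
qed

text \<open>Dynkin's argument from half-lines: complements by linearity, countable disjoint unions
  by the uniform L1 bound.\<close>

lemma cesaro_defect_indicator:
  assumes "B \<in> sets borel"
  shows "(\<lambda>n. cesaro_defect \<psi> n (indicator B)) \<longlonglongrightarrow> 0"
proof -
  have int: "integrable unit_lborel (indicator B :: real \<Rightarrow> real)" if "B \<in> sets borel" for B
    using that by (intro integrable_bounded borel_measurable_unit_lborelI) (auto simp: indicator_def)
  have const: "cesaro_defect \<psi> n (\<lambda>_. k) = 0" for n k
    using unit_lborel.prob_space by (simp add: cesaro_defect_def)
  have borel: "sets (borel :: real measure) = sigma_sets UNIV (range atMost)"
    unfolding borel_eq_atMost by (intro sets_measure_of) auto
  have "B \<in> sigma_sets UNIV (range atMost)" using assms borel by simp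
  have stable: "Int_stable (range atMost :: real set set)"
    by (auto simp: Int_stable_def)
  have "(range atMost :: real set set) \<subseteq> Pow UNIV" by simp
  from stable this \<open>B \<in> sigma_sets UNIV (range atMost)\<close> show ?thesis
  proof (induction rule: sigma_sets_induct_disjoint)
    case (basic A)
    then obtain t where A: "A = {..t}" by blast
    consider "t < 0" | "t \<in> {0..1}" | "1 < t" by fastforce
    then show ?case
    proof cases
      case 1
      then have "cesaro_defect \<psi> n (indicator A) = cesaro_defect \<psi> n (\<lambda>_. 0)" for n
        by (intro cesaro_defect_cong[OF \<psi>]) (auto simp: A indicator_def)
      then show ?thesis by (simp add: const)
    next
      case 2
      have "indicator A = (\<lambda>x. of_bool (x \<le> t) :: real)" by (auto simp: A indicator_def)
      then show ?thesis using cesaro_defect_atMost[OF 2] by simp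
    next
      case 3
      then have "cesaro_defect \<psi> n (indicator A) = cesaro_defect \<psi> n (\<lambda>_. 1)" for n
        by (intro cesaro_defect_cong[OF \<psi>]) (auto simp: A indicator_def)
      then show ?thesis by (simp add: const)
    qed
  next
    case empty
    have "indicator {} = (\<lambda>_::real. 0 :: real)" by auto
    then show ?case by (simp add: const)
  next
    case (compl A)
    then have A: "A \<in> sets borel" by (simp add: borel)
    have "indicator (UNIV - A) = (\<lambda>x. 1 - indicator A x :: real)" by (auto simp: indicator_def)
    then have "cesaro_defect \<psi> n (indicator (UNIV - A)) = - cesaro_defect \<psi> n (indicator A)" for n
      using cesaro_defect_diff[OF \<psi> _ int[OF A], of "\<lambda>_. 1"] by (simp add: const)
    then show ?case using tendsto_minus[OF compl.IH] by simp
  next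
    case (union A)
    then have A: "A i \<in> sets borel" for i by (auto simp: borel)
    have fin: "(\<lambda>n. cesaro_defect \<psi> n (\<lambda>x. \<Sum>i<N. indicator (A i) x)) \<longlonglongrightarrow> 0" for N
    proof (induction N)
      case 0
      then show ?case by (simp add: const)
    next
      case (Suc N)
      have "cesaro_defect \<psi> n (\<lambda>x. \<Sum>i<Suc N. indicator (A i) x) =
          cesaro_defect \<psi> n (\<lambda>x. \<Sum>i<N. indicator (A i) x) + cesaro_defect \<psi> n (indicator (A N))" for n
        using cesaro_defect_add[OF \<psi> _ int[OF A], of "\<lambda>x. \<Sum>i<N. indicator (A i) x"] int[OF A] by simp
      then show ?case using tendsto_add[OF Suc union.IH[of N]] by simp
    qed
    show ?case
    proof (rule cesaro_defect_tendsto_zero_limit[OF \<psi> _ _ fin])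
      show "integrable unit_lborel (indicator (\<Union>i. A i) :: real \<Rightarrow> real)"
        using A by (intro int) auto
      show "integrable unit_lborel (\<lambda>x. \<Sum>i<N. indicator (A i) x :: real)" for N
        using int[OF A] by simp
      have ind: "(\<Sum>i<N. indicator (A i) x) = (indicator (\<Union>i<N. A i) x :: real)" for N x
        using union(1) by (subst indicator_UN_disjoint) (auto simp: disjoint_family_on_def)
      have "(\<lambda>N. \<integral>x. \<bar>indicator (\<Union>i. A i) x - (\<Sum>i<N. indicator (A i) x) :: real\<bar> \<partial>unit_lborel) \<longlonglongrightarrow>
          (\<integral>x. 0 \<partial>unit_lborel)"
        unfolding ind
      proof (rule integral_dominated_convergence)
        show "integrable unit_lborel (\<lambda>_. 1 :: real)" by simp
        show "AE x in unit_lborel. (\<lambda>N. \<bar>indicator (\<Union>i. A i) x - indicator (\<Union>i<N. A i) x :: real\<bar>) \<longlonglongrightarrow> 0"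
        proof (rule AE_I2)
          fix x
          have "(\<lambda>N. indicator (\<Union>i<N. A i) x :: real) \<longlonglongrightarrow> indicator (\<Union>i. A i) x"
            by (rule LIMSEQ_indicator_UN)
          from tendsto_rabs[OF tendsto_diff[OF tendsto_const[of "indicator (\<Union>i. A i) x"] this]]
          show "(\<lambda>N. \<bar>indicator (\<Union>i. A i) x - indicator (\<Union>i<N. A i) x :: real\<bar>) \<longlonglongrightarrow> 0"
            by simp
        qed
        show "AE x in unit_lborel. norm \<bar>indicator (\<Union>i. A i) x - indicator (\<Union>i<N. A i) x :: real\<bar> \<le> 1" for N
          by (intro AE_I2) (auto simp: indicator_def)
        have "(\<lambda>x. \<bar>indicator (\<Union>i. A i) x - indicator (\<Union>i<N. A i) x :: real\<bar>) \<in> borel_measurable borel" for N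
          using A by measurable
        then show "(\<lambda>x. \<bar>indicator (\<Union>i. A i) x - indicator (\<Union>i<N. A i) x :: real\<bar>) \<in> borel_measurable unit_lborel" for N
          by (rule borel_measurable_unit_lborelI)
      qed simp
      then show "(\<lambda>N. \<integral>x. \<bar>indicator (\<Union>i. A i) x - (\<Sum>i<N. indicator (A i) x) :: real\<bar> \<partial>unit_lborel) \<longlonglongrightarrow> 0"
        by simp
    qed
  qed
qed

lemma cesaro_defect_tendsto_zero:
  assumes "integrable unit_lborel g"
  shows "(\<lambda>n. cesaro_defect \<psi> n g) \<longlonglongrightarrow> 0"
  using assms
proof (induction rule: integrable_induct)
  case (base A k)
  then have "A \<in> sets borel" by (auto simp: sets_unit_lborel sets_restrict_space)
  then have "(\<lambda>n. k * cesaro_defect \<psi> n (indicator A)) \<longlonglongrightarrow> k * 0"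
    by (intro tendsto_mult_left cesaro_defect_indicator)
  then show ?case
    using cesaro_defect_cmult[OF \<psi>, of _ k "indicator A"] by (simp add: mult.commute)
next
  case (add g h)
  then show ?case
    using tendsto_add[OF add(3) add(4)] cesaro_defect_add[OF \<psi> add(1) add(2)] by simp
next
  case (lim g s)
  show ?case
  proof (rule cesaro_defect_tendsto_zero_limit[OF \<psi> lim.hyps(4) lim.hyps(1) lim.IH])
    have "(\<lambda>i. \<integral>x. \<bar>g x - s i x\<bar> \<partial>unit_lborel) \<longlonglongrightarrow> (\<integral>x. 0 \<partial>unit_lborel)"
    proof (rule integral_dominated_convergence)
      \<comment> \<open>The simple approximants satisfy |s i x| \<le> 2 |g x|, which makes 3 |g| a
        majorant of the difference.\<close>
      show "integrable unit_lborel (\<lambda>x. 3 * \<bar>g x\<bar>)" using lim.hyps(4) by simp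
      show "AE x in unit_lborel. (\<lambda>i. \<bar>g x - s i x\<bar>) \<longlonglongrightarrow> 0"
      proof (rule AE_I2)
        fix x assume "x \<in> space unit_lborel"
        from tendsto_rabs[OF tendsto_diff[OF tendsto_const[of "g x"] lim.hyps(2)[OF this]]]
        show "(\<lambda>i. \<bar>g x - s i x\<bar>) \<longlonglongrightarrow> 0" by simp
      qed
      show "AE x in unit_lborel. norm \<bar>g x - s i x\<bar> \<le> 3 * \<bar>g x\<bar>" for i
      proof (rule AE_I2)
        fix x assume "x \<in> space unit_lborel"
        then have "\<bar>s i x\<bar> \<le> 2 * \<bar>g x\<bar>" using lim.hyps(3)[of x i] by simp
        then show "norm \<bar>g x - s i x\<bar> \<le> 3 * \<bar>g x\<bar>" by simp
      qed
    qed (use lim.hyps(1,4) in auto)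
    then show "(\<lambda>i. \<integral>x. \<bar>g x - s i x\<bar> \<partial>unit_lborel) \<longlonglongrightarrow> 0" by simp
  qed
qed

text \<open>On the left \<open>h\<close> enters only through its total mass. So two invariant
  densities of equal mass have equal integrals, and the sign of the limit is that of the mass when
  \<psi> is nonnegative.\<close>

lemma cesaro_average_limit:
  assumes h: "integrable unit_lborel h" "weakly_invariant f h"
  shows "(\<lambda>n. (\<integral>x. h x \<partial>unit_lborel) * ((\<Sum>j<n. \<integral>x. \<psi> ((f ^^ j) x) \<partial>unit_lborel) / real n))
    \<longlonglongrightarrow> (\<integral>x. h x * \<psi> x \<partial>unit_lborel)"
proof -
  have eq: "cesaro_defect \<psi> n h = (\<integral>x. h x * \<psi> x \<partial>unit_lborel)
    - (\<integral>x. h x \<partial>unit_lborel) * ((\<Sum>j<n. \<integral>x. \<psi> ((f ^^ j) x) \<partial>unit_lborel) / real n)" if "n > 0" for n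
    by (rule cesaro_defect_weakly_invariant[OF \<psi> h that])
  have "(\<lambda>n. (\<integral>x. h x * \<psi> x \<partial>unit_lborel) - cesaro_defect \<psi> n h) \<longlonglongrightarrow> (\<integral>x. h x * \<psi> x \<partial>unit_lborel) - 0"
    by (intro tendsto_diff tendsto_const cesaro_defect_tendsto_zero h)
  then have "(\<lambda>n. (\<integral>x. h x * \<psi> x \<partial>unit_lborel) - cesaro_defect \<psi> n h) \<longlonglongrightarrow> (\<integral>x. h x * \<psi> x \<partial>unit_lborel)"
    by simp
  then show ?thesis
  proof (rule Lim_transform_eventually)
    show "\<forall>\<^sub>F n in sequentially. (\<integral>x. h x * \<psi> x \<partial>unit_lborel) - cesaro_defect \<psi> n h =
        (\<integral>x. h x \<partial>unit_lborel) * ((\<Sum>j<n. \<integral>x. \<psi> ((f ^^ j) x) \<partial>unit_lborel) / real n)"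
      using eventually_gt_at_top[of 0]
      by eventually_elim (simp add: eq)
  qed
qed

end

lemma overlap_acim_unique:
  assumes \<mu>: "acim f \<mu>" and \<nu>: "acim f \<nu>"
  shows "\<mu> = \<nu>"
proof -
  obtain h where h: "integrable unit_lborel h" "\<forall>x. 0 \<le> h x" "(\<integral>x. h x \<partial>unit_lborel) = (1::real)"
    and \<mu>_eq: "\<mu> = density unit_lborel (\<lambda>x. ennreal (h x))" and h_inv: "weakly_invariant f h"
    using acim_density[OF measurable_f \<mu>] by blast
  obtain k where k: "integrable unit_lborel k" "\<forall>x. 0 \<le> k x" "(\<integral>x. k x \<partial>unit_lborel) = (1::real)"
    and \<nu>_eq: "\<nu> = density unit_lborel (\<lambda>x. ennreal (k x))" and k_inv: "weakly_invariant f k"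
    using acim_density[OF measurable_f \<nu>] by blast
  show ?thesis
  proof (rule measure_eqI)
    show "sets \<mu> = sets \<nu>" by (simp add: \<mu>_eq \<nu>_eq)
    fix B assume "B \<in> sets \<mu>"
    then have B: "B \<in> sets unit_lborel" by (simp add: \<mu>_eq)
    note test = indicator_test_function[OF B]
    have "(\<integral>x. h x * indicator B x \<partial>unit_lborel) = (\<integral>x. k x * indicator B x \<partial>unit_lborel)"
      using cesaro_average_limit[OF test h(1) h_inv] cesaro_average_limit[OF test k(1) k_inv]
      unfolding h(3) k(3) by (rule LIMSEQ_unique)
    then show "emeasure \<mu> B = emeasure \<nu> B"
      unfolding \<mu>_eq \<nu>_eq using h k B by (subst (1 2) emeasure_density_real) auto
  qed
qed

text \<open>If the integral \<open>k\<close> were 0, the average limits would make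
  \<open>green 1\<close> integrate to 0 over every set, against its nontriviality. Otherwise
  \<open>green 1 / k\<close> integrates over each set to a limit of nonnegative averages.\<close>

lemma overlap_acim_exists:
  obtains k where "acim f (density unit_lborel (\<lambda>x. ennreal (green 1 x / k)))"
    "has_density (density unit_lborel (\<lambda>x. ennreal (green 1 x / k))) (\<lambda>x. green 1 x / k)"
proof -
  define k where "k = (\<integral>x. green 1 x \<partial>unit_lborel)"
  have int: "integrable unit_lborel (green 1)" by (intro integrable_green) auto
  have avg: "(\<lambda>n. k * ((\<Sum>j<n. \<integral>x. indicator B ((f ^^ j) x) \<partial>unit_lborel) / real n))
    \<longlonglongrightarrow> (\<integral>x. green 1 x * indicator B x \<partial>unit_lborel)" if "B \<in> sets unit_lborel" for B
    unfolding k_def by (rule cesaro_average_limit[OF indicator_test_function[OF that] int weakly_invariant_green])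
  have "k \<noteq> 0"
  proof
    assume "k = 0"
    then have z: "(\<integral>x. green 1 x * indicator B x \<partial>unit_lborel) = 0" if "B \<in> sets unit_lborel" for B
      using avg[OF that] LIMSEQ_unique[OF tendsto_const] by fastforce
    have "AE x in unit_lborel. 0 \<le> green 1 x"
      by (rule AE_nonneg_if_integrals_nonneg[OF int]) (simp add: z)
    moreover have "AE x in unit_lborel. 0 \<le> - green 1 x"
      by (rule AE_nonneg_if_integrals_nonneg) (use int z in auto)
    ultimately have "AE x in unit_lborel. green 1 x = 0"
      by eventually_elim simp
    then show False using green_not_AE_zero by simp
  qed
  have int': "integrable unit_lborel (\<lambda>x. green 1 x / k)" using int by simp
  have nonneg: "AE x in unit_lborel. 0 \<le> green 1 x / k"
  proof (rule AE_nonneg_if_integrals_nonneg[OF int'])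
    fix B assume B: "B \<in> sets unit_lborel"
    have "(\<lambda>n. k * ((\<Sum>j<n. \<integral>x. indicator B ((f ^^ j) x) \<partial>unit_lborel) / real n) / k)
        \<longlonglongrightarrow> (\<integral>x. green 1 x * indicator B x \<partial>unit_lborel) / k"
      using avg[OF B] \<open>k \<noteq> 0\<close> by (intro tendsto_divide tendsto_const)
    then have "0 \<le> (\<integral>x. green 1 x * indicator B x \<partial>unit_lborel) / k"
    proof (rule LIMSEQ_le_const)
      show "\<exists>N. \<forall>n\<ge>N. 0 \<le> k * ((\<Sum>j<n. \<integral>x. indicator B ((f ^^ j) x) \<partial>unit_lborel) / real n) / k"
        using \<open>k \<noteq> 0\<close> by (auto intro!: divide_nonneg_nonneg sum_nonneg integral_nonneg)
    qed
    then show "0 \<le> (\<integral>x. green 1 x / k * indicator B x \<partial>unit_lborel)" by simp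
  qed
  have "(\<integral>x. green 1 x / k \<partial>unit_lborel) = 1" using \<open>k \<noteq> 0\<close> by (simp add: k_def)
  moreover have "weakly_invariant f (\<lambda>x. green 1 x / k)"
    by (intro weakly_invariant_divide weakly_invariant_green)
  ultimately have "acim f (density unit_lborel (\<lambda>x. ennreal (green 1 x / k)))"
    by (intro acimI measurable_f int' nonneg)
  moreover have "has_density (density unit_lborel (\<lambda>x. ennreal (green 1 x / k))) (\<lambda>x. green 1 x / k)"
    using int' nonneg by (auto simp: has_density_def)
  ultimately show ?thesis by (rule that)
qed

end

theorem theoremA:
  fixes a b c :: real
  defines "f \<equiv> lorenz_map a b c"
  assumes "a > 0" and "b > 0" and "0 < c" and "c < 1"
    and "a * c \<le> 1" and "b * (1 - c) \<le> 1"
  shows "((\<exists>\<mu>. acim f \<mu>) \<longleftrightarrow> f 0 \<le> f 1) \<and>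
    (f 0 \<le> f 1 \<longleftrightarrow> a * c + b * (1 - c) \<ge> 1) \<and>
    (a * c + b * (1 - c) = 1 \<and> (a, b) \<noteq> (1, 1) \<and> ln a / ln b \<in> \<rat> \<longrightarrow>
      (\<exists>n>0. (\<forall>x\<in>{0..1}. (circle_map f ^^ n) (circle_rel `` {x}) = circle_rel `` {x}) \<and>
        (\<forall>g. prob_density g \<longrightarrow> (\<exists>\<mu>. acim f \<mu> \<and> has_density \<mu> (cesaro_mean a b c n g))))) \<and>
    (a * c + b * (1 - c) = 1 \<and> (a, b) \<noteq> (1, 1) \<and> ln a / ln b \<notin> \<rat> \<longrightarrow>
      (\<exists>!\<mu>. acim f \<mu>) \<and>
      (let r = min ((a / b) ^ 4) ((a / b) powi (- 4)) in
        \<forall>\<mu>. acim f \<mu> \<longrightarrow>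
          (\<exists>h. has_density \<mu> h \<and> (AE x in unit_lborel. r \<le> h x \<and> h x \<le> 1 / r)))) \<and>
    (a * c + b * (1 - c) > 1 \<longrightarrow>
      (\<exists>!\<mu>. acim f \<mu>) \<and>
      (\<forall>\<mu>. acim f \<mu> \<longrightarrow> (\<exists>h. has_density \<mu> h \<and> bounded_variation_on 0 1 h))) \<and>
    (a * c + b * (1 - c) < 1 \<longrightarrow> \<not> (\<exists>\<mu>. acim f \<mu>))"
proof -
  interpret lorenz a b c
    using assms(2-) by unfold_locales auto
  let ?E = "a * c + b * (1 - c)"
  have order: "f 0 \<le> f 1 \<longleftrightarrow> 1 \<le> ?E"
    using \<open>0 < c\<close> \<open>c < 1\<close> by (auto simp: f_def lorenz_map_def)
  have gap: "\<not> (\<exists>\<mu>. acim f \<mu>)" if "?E < 1"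
    using no_acim_if_gap[OF that] by (simp add: f_def)
  \<comment> \<open>Includes \<open>(a, b) = (1, 1)\<close>, which the rational and irrational cases
    leave out but the existence criterion does not.\<close>
  have isometric: "\<exists>\<mu>. acim f \<mu>" if "?E = 1"
  proof -
    interpret critical_lorenz a b c by unfold_locales (rule that)
    show ?thesis unfolding f_def using acim_inverse_weight(3) by blast
  qed
  have rational: "\<exists>n>0. (\<forall>x\<in>{0..1}. (circle_map f ^^ n) (circle_rel `` {x}) = circle_rel `` {x}) \<and>
      (\<forall>g. prob_density g \<longrightarrow> (\<exists>\<mu>. acim f \<mu> \<and> has_density \<mu> (cesaro_mean a b c n g)))"
    if H: "?E = 1" "(a, b) \<noteq> (1, 1)" "ln a / ln b \<in> \<rat>"
  proof -
    interpret nonrigid_critical_lorenz a b c by unfold_locales (use H in auto)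
    obtain n where n: "n > 0"
      and per: "\<And>x. x \<in> {0..1} \<Longrightarrow> (x, (lorenz_map a b c ^^ n) x) \<in> circle_rel"
      using rational_rotation_period[OF H(3)] by metis
    show ?thesis
      unfolding f_def
    proof (intro exI conjI ballI allI impI)
      show "0 < n" by (rule n)
      show "(circle_map (lorenz_map a b c) ^^ n) (circle_rel `` {x}) = circle_rel `` {x}"
        if "x \<in> {0..1}" for x
        unfolding circle_map_funpow_class[OF that]
        using equiv_class_eq[OF equiv_circle_rel per[OF that]] by simp
      show "acim (lorenz_map a b c) (density unit_lborel (\<lambda>x. ennreal (cesaro_mean a b c n g x)))"
        if "prob_density g" for g
        by (rule periodic_imp_acim_cesaro(1)[OF n per that])
      show "has_density (density unit_lborel (\<lambda>x. ennreal (cesaro_mean a b c n g x))) (cesaro_mean a b c n g)"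
        if "prob_density g" for g
        by (rule periodic_imp_acim_cesaro(2)[OF n per that])
    qed
  qed
  have irrational: "(\<exists>!\<mu>. acim f \<mu>) \<and>
      (let r = min ((a / b) ^ 4) ((a / b) powi (- 4)) in
        \<forall>\<mu>. acim f \<mu> \<longrightarrow>
          (\<exists>h. has_density \<mu> h \<and> (AE x in unit_lborel. r \<le> h x \<and> h x \<le> 1 / r)))"
    if H: "?E = 1" "(a, b) \<noteq> (1, 1)" "ln a / ln b \<notin> \<rat>"
  proof -
    interpret nonrigid_critical_lorenz a b c by unfold_locales (use H in auto)
    have "\<exists>!\<mu>. acim f \<mu>"
      using isometric[OF H(1)] acim_unique_if_irrational[OF H(3)] unfolding f_def by blast
    then show ?thesis
      using irrational_acim_bounds[OF H(3)] unfolding f_def Let_def by blast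
  qed
  have overlapping: "(\<exists>!\<mu>. acim f \<mu>) \<and>
      (\<forall>\<mu>. acim f \<mu> \<longrightarrow> (\<exists>h. has_density \<mu> h \<and> bounded_variation_on 0 1 h))"
    if "?E > 1"
  proof -
    interpret overlapping_lorenz a b c by unfold_locales (rule that)
    obtain k where k: "acim f (density unit_lborel (\<lambda>x. ennreal (green 1 x / k)))"
      "has_density (density unit_lborel (\<lambda>x. ennreal (green 1 x / k))) (\<lambda>x. green 1 x / k)"
      unfolding f_def by (rule overlap_acim_exists)
    have unique: "\<mu> = density unit_lborel (\<lambda>x. ennreal (green 1 x / k))" if "acim f \<mu>" for \<mu>
      using overlap_acim_unique that k(1) unfolding f_def by blast
    then show ?thesis
      using k bounded_variation_green by blast
  qed
  have "(\<exists>\<mu>. acim f \<mu>) \<longleftrightarrow> f 0 \<le> f 1"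
    unfolding order using gap isometric overlapping by (cases ?E "1 :: real" rule: linorder_cases) auto
  then show ?thesis
    using order gap rational irrational overlapping by blast
qed

end
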